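(* Let $S$ be a set of positive integers, $k\ge2$ an integer, and $a_0$ a nonnegative integer. Let $f,g$ be functions on $\mathbb{N}$ with $f(N)\ge2$ such that for all $N\in\mathbb{N}$: (1) for any sets $B_1,\dots,B_k\subseteq[N]$ with $a_0+\sum_{i\in I}B_i\subseteq S$ for all nonempty $I\subseteq[k]$, we have $\min_{1\le i\le k}|B_i|\le f(N)$; (2) $S\cap[a_0,a_0+N]$ contains no arithmetic progression of length $g(N)$. Then: (a) If $A\subseteq\mathbb{N}$ is a multiset with $a_0+\Sigma^*(A)\subseteq S\cap[a_0,a_0+N]$, then $|A|\ll k\,g(N)\log f(N)$, with an absolute implied constant. (b) Assume $f(N)\to\infty$ as $N\to\infty$. For any $\varepsilon>0$, if $A\subseteq\mathbb{N}$ is a multiset with $a_0+\Sigma^*(A)\subseteq S\cap[a_0,a_0+N]$, then $|A|\ll_{k,\varepsilon}\max\{f(N)^{\varepsilon},g(N)\}$. (c) Assume $f(N)\to\infty$ as $N\to\infty$. For any $\varepsilon>0$, if $A\subseteq\mathbb{N}$ is a set with $a_0+\Sigma^*(A)\subseteq S\cap[a_0,a_0+N]$, then $|A|\ll_{k,\varepsilon}\max\{f(N)^{\varepsilon},g(N)^{1-\delta}\}$, where one can take $\delta=1/(\lfloor2(3k/\varepsilon-1)\rfloor+1)!$.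
   Context: $[N]=\{1,\dots,N\}$; $[a_0,a_0+N]$ is the set of integers in that interval. For a multiset $A=\{a_1,\dots,a_d\}$, $\Sigma^*(A)=\{\sum_i\varepsilon_ia_i:\varepsilon_i\in\{0,1\},\sum\varepsilon_i>0\}$; $|A|$ counts multiplicity. $\ll_{k,\varepsilon}$ means up to a constant depending only on $k,\varepsilon$. *)

theory Defs
  imports Complex_Main "HOL-Library.Multiset" "HOL-Library.Set_Algebras"
begin

definition subset_sums :: "nat multiset \<Rightarrow> nat set" where
  "subset_sums A = {sum_mset B |B. B \<subseteq># A \<and> B \<noteq> {#}}"

text \<open>An arithmetic progression has a nonzero common difference; the empty progression
  has length 0.\<close>

definition contains_AP :: "nat set \<Rightarrow> nat \<Rightarrow> bool" where
  "contains_AP T L \<longleftrightarrow> (\<exists>a d. d > 0 \<and> (\<lambda>i. a + i * d) ` {..<L} \<subseteq> T)"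

text \<open>Sums of sets are Minkowski sums. As \<^term>\<open>g N\<close> need not be an integer, ``no progression of
  length \<^term>\<open>g N\<close>'' is read as ``no progression of an integer length \<^term>\<open>L \<ge> g N\<close>'';
  for integer \<^term>\<open>g N\<close> the two agree, since progressions may be truncated.\<close>

definition cube_AP_free ::
  "nat set \<Rightarrow> nat \<Rightarrow> nat \<Rightarrow> (nat \<Rightarrow> real) \<Rightarrow> (nat \<Rightarrow> real) \<Rightarrow> bool" where
  "cube_AP_free S k a\<^sub>0 f g \<longleftrightarrow>
     (\<forall>N\<ge>1.
        f N \<ge> 2 \<and>
        (\<forall>B :: nat \<Rightarrow> nat set.
           (\<forall>i\<in>{1..k}. B i \<subseteq> {1..N}) \<longrightarrow>
           (\<forall>I. I \<subseteq> {1..k} \<and> I \<noteq> {} \<longrightarrow> a\<^sub>0 +o (\<Sum>i\<in>I. B i) \<subseteq> S) \<longrightarrow>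
           real (MIN i\<in>{1..k}. card (B i)) \<le> f N) \<and>
        (\<forall>L. real L \<ge> g N \<longrightarrow> \<not> contains_AP (S \<inter> {a\<^sub>0..a\<^sub>0 + N}) L))"

text \<open>The argument of the factorial is negative only for \<open>\<epsilon> > 6 * k\<close>, where the truncation
  by \<^const>\<open>nat\<close> gives \<open>\<delta> = 1\<close>.\<close>

definition delta :: "nat \<Rightarrow> real \<Rightarrow> real" where
  "delta k \<epsilon> = 1 / fact (nat (\<lfloor>2 * (3 * real k / \<epsilon> - 1)\<rfloor> + 1))"

end

theory Submission
  imports Defs "HOL-Library.FuncSet"
begin

text \<open>
  Cut \<open>A\<close> into \<open>k\<close> parts of equal size; by the cube hypothesis one part \<open>P\<close> has at most \<open>f N\<close> subset
  sums. If \<open>X\<close> is the set of subset sums of a block and \<open>a + X\<close> sticks out of \<open>X\<close> in fewer than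
  \<open>|X| / s\<close> elements, then \<open>X\<close> contains a progression with \<open>s\<close> steps of difference \<open>a\<close>. Without
  long progressions every new element therefore multiplies the number of subset sums by
  \<open>1 + 1 / s\<close>, which is (a).

  If \<open>P\<close> has only polynomially many subset sums, a greedy choice gives a block \<open>B\<close> such that all
  remaining \<open>a\<close> stick out in a proportion \<open>O(1 / |B|)\<close>. Many disjoint such blocks, all giving
  progressions with the same difference, combine to a progression of length linear in \<open>|P|\<close>, which
  is (b).

  For (c), grouping the blocks gives boxes \<open>x + \<Sum>\<^sub>d c\<^sub>d d\<close> with \<open>0 \<le> c\<^sub>d \<le> l\<close> of linear side \<open>l\<close> over
  any few remaining elements. As there are few subset sums, the remaining elements satisfy linear
  relations with coefficients much smaller than \<open>l\<close>; as they are distinct, some primitive relation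
  has a coefficient \<open>H\<close> that is at least a power of \<open>|P|\<close>. The lattice of coefficient vectors modulo
  this relation is \<open>H\<close> times finer than the one obtained by omitting that element, so by Dirichlet's
  pigeonhole argument it has a short vector, and in its direction the box contains a progression
  that is longer than \<open>l\<close> by a factor which is a power of \<open>H\<close>.
\<close>

section \<open>Growth of the set of subset sums\<close>

text \<open>Unlike \<open>subset_sums\<close>, the empty sum is allowed, so that adding an element
  \<open>a\<close> turns the set of sums \<open>X\<close> into the union of \<open>X\<close> and
  \<open>a + X\<close>.\<close>

definition msums :: "nat multiset \<Rightarrow> nat set" where
  "msums A = sum_mset ` {B. B \<subseteq># A}"

lemma msumsI: "B \<subseteq># A \<Longrightarrow> sum_mset B \<in> msums A"
  by (auto simp: msums_def)

lemma msums_empty [simp]: "msums {#} = {0}"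
  by (auto simp: msums_def)

lemma zero_in_msums [simp]: "0 \<in> msums A"
  using msumsI[of "{#}" A] by simp

lemma msums_add_mset: "msums (add_mset a A) = msums A \<union> (+) a ` msums A"
proof (intro equalityI subsetI)
  fix x assume "x \<in> msums (add_mset a A)"
  then obtain B where B: "B \<subseteq># add_mset a A" "x = sum_mset B"
    by (auto simp: msums_def)
  show "x \<in> msums A \<union> (+) a ` msums A"
  proof (cases "a \<in># B")
    case True
    then obtain B' where B': "B = add_mset a B'"
      by (metis insert_DiffM)
    then have "B' \<subseteq># A"
      using B(1) by simp
    then show ?thesis
      using B(2) B' by (auto intro!: imageI msumsI)
  next
    case False
    then have "B \<subseteq># A"
      using B(1) unfolding subseteq_mset_def by (metis count_add_mset count_inI zero_le)
    then show ?thesis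
      using B(2) by (auto intro: msumsI)
  qed
next
  fix x assume "x \<in> msums A \<union> (+) a ` msums A"
  then consider B where "B \<subseteq># A" "x = sum_mset B" | B where "B \<subseteq># A" "x = a + sum_mset B"
    by (auto simp: msums_def)
  then show "x \<in> msums (add_mset a A)"
  proof cases
    case (1 B)
    then have "B \<subseteq># add_mset a A"
      by (auto intro: subset_mset.order_trans)
    then show ?thesis
      using 1 msumsI by blast
  next
    case (2 B)
    then show ?thesis
      using msumsI[of "add_mset a B" "add_mset a A"] by simp
  qed
qed

lemma finite_msums [simp]: "finite (msums A)"
  by (induction A) (auto simp: msums_add_mset)

lemma card_msums_pos: "0 < card (msums A)"
  using zero_in_msums[of A] by (metis card_gt_0_iff empty_iff finite_msums)

lemma msums_mono: "A \<subseteq># B \<Longrightarrow> msums A \<subseteq> msums B"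
  unfolding msums_def using subset_mset.order_trans by blast

lemma card_msums_mono: "A \<subseteq># B \<Longrightarrow> card (msums A) \<le> card (msums B)"
  by (simp add: card_mono msums_mono)

lemma msums_union: "x \<in> msums A \<Longrightarrow> y \<in> msums B \<Longrightarrow> x + y \<in> msums (A + B)"
  unfolding msums_def
  by (auto simp flip: sum_mset.union intro!: imageI subset_mset.add_mono)

lemma card_msums_add_mset:
  "card (msums (add_mset a A)) = card (msums A) + card ((+) a ` msums A - msums A)"
proof -
  have "msums (add_mset a A) = msums A \<union> ((+) a ` msums A - msums A)"
    by (auto simp: msums_add_mset)
  also have "card \<dots> = card (msums A) + card ((+) a ` msums A - msums A)"
    by (rule card_Un_disjoint) auto
  finally show ?thesis .
qed

lemma msums_eq_subset_sums: "msums A = insert 0 (subset_sums A)"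
proof -
  have "{B. B \<subseteq># A} = insert {#} {B. B \<subseteq># A \<and> B \<noteq> {#}}"
    by auto
  moreover have "subset_sums A = sum_mset ` {B. B \<subseteq># A \<and> B \<noteq> {#}}"
    unfolding subset_sums_def by blast
  ultimately show ?thesis
    by (simp add: msums_def)
qed

lemma finite_subset_sums [simp]: "finite (subset_sums A)"
  using finite_msums[of A] by (simp add: msums_eq_subset_sums)

lemma subset_sums_mono: "A \<subseteq># B \<Longrightarrow> subset_sums A \<subseteq> subset_sums B"
  unfolding subset_sums_def using subset_mset.order_trans by blast

lemma subset_sumsI: "B \<subseteq># A \<Longrightarrow> B \<noteq> {#} \<Longrightarrow> sum_mset B \<in> subset_sums A"
  unfolding subset_sums_def mem_Collect_eq by (intro exI[of _ B]) simp

lemma subset_sums_pos: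
  assumes "0 \<notin># A" "x \<in> subset_sums A"
  shows "0 < x"
proof -
  obtain B where B: "B \<subseteq># A" "B \<noteq> {#}" "x = sum_mset B"
    using assms(2) by (auto simp: subset_sums_def)
  then obtain b where b: "b \<in># B"
    by blast
  then have "b \<le> x"
    by (metis B(3) le_add1 multi_member_split sum_mset.add_mset)
  moreover have "b \<noteq> 0"
    using b B(1) assms(1) by (metis mset_subset_eqD)
  ultimately show ?thesis
    by simp
qed

lemma set_mset_subset_sums: "set_mset A \<subseteq> subset_sums A"
proof
  fix a assume "a \<in># A"
  then show "a \<in> subset_sums A"
    using subset_sumsI[of "{#a#}" A] by simp
qed

lemma add_msums_in_subset_sums:
  assumes "E \<subseteq># A" "a \<in># A - E" "x \<in> msums E"
  shows "a + x \<in> subset_sums A"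
proof -
  obtain B where B: "B \<subseteq># E" "x = sum_mset B"
    using assms(3) by (auto simp: msums_def)
  have "{#a#} + B \<subseteq># (A - E) + E"
    using assms(2) B(1) by (intro subset_mset.add_mono) simp_all
  then have "add_mset a B \<subseteq># A"
    using assms(1) by simp
  then show ?thesis
    using subset_sumsI[of "add_mset a B" A] B(2) by simp
qed

section \<open>Progressions forced by slow growth\<close>

text \<open>Otherwise every \<open>x\<close> in \<open>X\<close> leaves \<open>X\<close> within
  \<open>s\<close> steps of size \<open>a\<close>. The first exit point lies in the boundary, its
  predecessor still being in \<open>X\<close>. Since \<open>x\<close> is recovered from the exit
  point and the number of steps, \<open>X\<close> has at most \<open>s\<close> times as many
  elements as the boundary.\<close>

lemma AP_of_small_boundary:
  fixes X :: "nat set"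
  assumes fin: "finite X" and small: "s * card ((+) a ` X - X) < card X"
  shows "\<exists>x. \<forall>i\<le>s. x + i * a \<in> X"
proof (rule ccontr)
  assume neg: "\<not> ?thesis"
  define U where "U = (+) a ` X - X"
  have "\<exists>i. i \<in> {1..s} \<and> x + i * a \<in> U" if x: "x \<in> X" for x
  proof -
    obtain j where j: "j \<le> s" "x + j * a \<notin> X"
      using neg by blast
    define i where "i = (LEAST i. x + i * a \<notin> X)"
    have i: "x + i * a \<notin> X"
      unfolding i_def by (rule LeastI) (rule j(2))
    have ij: "i \<le> j"
      unfolding i_def by (rule Least_le) (rule j(2))
    have i0: "i \<noteq> 0"
      using i x by (intro notI) simp
    then obtain i' where i': "i = Suc i'"
      using not0_implies_Suc by blast
    have "x + i' * a \<in> X"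
      using not_less_Least[of i' "\<lambda>i. x + i * a \<notin> X"] i' by (auto simp: i_def)
    then have "x + i * a \<in> (+) a ` X"
      by (auto simp: i' image_iff algebra_simps)
    then have "x + i * a \<in> U"
      using i by (simp add: U_def)
    then show ?thesis
      using i0 ij j(1) by (intro exI[of _ i]) auto
  qed
  then obtain h where h: "\<And>x. x \<in> X \<Longrightarrow> h x \<in> {1..s} \<and> x + h x * a \<in> U"
    by metis
  have "card X \<le> card ({1..s} \<times> U)"
  proof (rule card_inj_on_le)
    show "inj_on (\<lambda>x. (h x, x + h x * a)) X"
      by (auto simp: inj_on_def)
    show "(\<lambda>x. (h x, x + h x * a)) ` X \<subseteq> {1..s} \<times> U"
      using h by blast
    show "finite ({1..s} \<times> U)"
      using fin by (simp add: U_def)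
  qed
  then have "card X \<le> s * card U"
    by (simp add: card_cartesian_product)
  then show False
    using small by (simp add: U_def)
qed

text \<open>By the previous lemma each new element multiplies the number of sums by at least
  \<open>1 + 1 / s\<close>; denominators are cleared to stay in the natural numbers.\<close>

lemma msums_exponential_growth:
  assumes "0 < s" and noAP: "\<And>a. a \<in># A \<Longrightarrow> \<not> (\<exists>x. \<forall>i\<le>s. x + i * a \<in> msums A)"
  shows "(s + 1) ^ size A \<le> card (msums A) * s ^ size A"
  using noAP
proof (induction A)
  case empty
  then show ?case by simp
next
  case (add a A)
  have noAP': "\<not> (\<exists>x. \<forall>i\<le>s. x + i * b \<in> msums A)" if "b \<in># add_mset a A" for b
  proof -
    have "msums A \<subseteq> msums (add_mset a A)"
      by (simp add: msums_mono)
    then show ?thesis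
      using add.prems[OF that] by blast
  qed
  have IH: "(s + 1) ^ size A \<le> card (msums A) * s ^ size A"
    by (rule add.IH) (simp add: noAP')
  have "card (msums A) \<le> s * card ((+) a ` msums A - msums A)"
    using AP_of_small_boundary[of "msums A" s a] noAP'[of a] by fastforce
  then have step: "(s + 1) * card (msums A) \<le> card (msums (add_mset a A)) * s"
    by (simp add: card_msums_add_mset algebra_simps)
  have "(s + 1) ^ size (add_mset a A) \<le> (s + 1) * (card (msums A) * s ^ size A)"
    using mult_left_mono[OF IH, of "s + 1"] by simp
  also have "\<dots> = ((s + 1) * card (msums A)) * s ^ size A"
    by (simp only: mult.assoc)
  also have "\<dots> \<le> (card (msums (add_mset a A)) * s) * s ^ size A"
    by (rule mult_right_mono[OF step]) simp
  also have "\<dots> = card (msums (add_mset a A)) * s ^ size (add_mset a A)"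
    by simp
  finally show ?case .
qed

section \<open>Disjoint blocks and the boxes they generate\<close>

lemma ex_submultiset_size:
  assumes "n \<le> size A"
  shows "\<exists>B. B \<subseteq># A \<and> size B = n"
proof -
  obtain xs where xs: "mset xs = A"
    using ex_mset by blast
  have "mset (take n xs) \<subseteq># A"
    unfolding xs[symmetric] by (metis append_take_drop_id mset_append mset_subset_eq_add_left)
  moreover have "size (mset (take n xs)) = n"
    using assms xs by (metis length_take min.absorb2 size_mset)
  ultimately show ?thesis by blast
qed

text \<open>If no block were good, greedily adding the worst element would multiply the number of subset
  sums of a block of size \<open>j\<close> by \<open>(j + K) / j\<close>, hence make it grow at least like
  \<open>(j + K choose K)\<close>.\<close>

lemma polynomial_growth_block:
  assumes K: "1 \<le> K" "K \<le> t" "t \<le> size A"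
    and small: "4 ^ K * card (msums A) < (t + K) choose K"
  shows "\<exists>B. B \<subseteq># A \<and> K \<le> size B \<and> size B \<le> t \<and>
    (\<forall>a\<in>#A - B. card ((+) a ` msums B - msums B) * size B < K * card (msums B))"
proof (rule ccontr)
  assume neg: "\<not> ?thesis"
  have "\<exists>B. B \<subseteq># A \<and> size B = j \<and> (j + K) choose K \<le> 4 ^ K * card (msums B)"
    if "K \<le> j" "j \<le> t" for j
    using that
  proof (induction j rule: dec_induct)
    case base
    obtain B where B: "B \<subseteq># A" "size B = K"
      using ex_submultiset_size[of K A] K by auto
    \<comment> \<open>The factor \<open>4 ^ K\<close> in the claim pays for this base case, where
      nothing is known about the block of size \<open>K\<close>.\<close>
    have "(K + K) choose K \<le> 4 ^ K"
      using binomial_le_pow2[of "K + K" K] by (simp add: power_add flip: power_mult_distrib)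
    also have "\<dots> \<le> 4 ^ K * card (msums B)"
      using card_msums_pos[of B] by simp
    finally show ?case using B by blast
  next
    case (step j)
    then obtain B where B: "B \<subseteq># A" "size B = j" "(j + K) choose K \<le> 4 ^ K * card (msums B)"
      by auto
    obtain a where a: "a \<in># A - B"
      and grow: "K * card (msums B) \<le> card ((+) a ` msums B - msums B) * j"
    proof -
      have "\<not> (\<forall>a\<in>#A - B. card ((+) a ` msums B - msums B) * size B < K * card (msums B))"
        using neg B step.hyps step.prems by auto
      then show ?thesis
        using that B(2) by (auto simp: not_less)
    qed
    have sub: "add_mset a B \<subseteq># A"
    proof -
      have "{#a#} + B \<subseteq># (A - B) + B"
        using a by (intro subset_mset.add_mono) auto
      then show ?thesis
        using B(1) by simp
    qed
    have "j * (4 ^ K * card (msums (add_mset a B))) \<ge> (j + K) * (4 ^ K * card (msums B))"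
    proof -
      have "(j + K) * card (msums B) \<le> j * card (msums (add_mset a B))"
        using grow by (simp add: card_msums_add_mset algebra_simps)
      then have "4 ^ K * ((j + K) * card (msums B)) \<le> 4 ^ K * (j * card (msums (add_mset a B)))"
        by (rule mult_left_mono) simp
      then show ?thesis by (simp only: ac_simps)
    qed
    then have 1: "(j + K) * ((j + K) choose K) \<le> j * (4 ^ K * card (msums (add_mset a B)))"
      using mult_left_mono[OF B(3), of "j + K"] by linarith
    define b where "b = (j + K) choose K"
    define b' where "b' = (Suc j + K) choose K"
    \<comment> \<open>The binomial coefficient grows by \<open>(Suc j + K) / Suc j\<close>, which is
      at most the factor \<open>(j + K) / j\<close> by which the number of sums grows.\<close>
    have bb: "Suc j * b' = (Suc j + K) * b"
    proof -
      have "Suc j * ((Suc (j + K)) choose Suc j) = Suc (j + K) * ((j + K) choose j)"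
        by (rule Suc_times_binomial)
      moreover have "(Suc (j + K)) choose Suc j = b'"
        unfolding b'_def using binomial_symmetric[of "Suc j" "Suc (j + K)"] by simp
      moreover have "(j + K) choose j = b"
        unfolding b_def using binomial_symmetric[of j "j + K"] by simp
      ultimately show ?thesis by simp
    qed
    have "Suc j * (j * b') = j * (Suc j + K) * b"
      using bb by (metis mult.assoc mult.left_commute)
    also have "\<dots> \<le> Suc j * (j + K) * b"
      by (rule mult_right_mono) (simp_all add: algebra_simps)
    finally have "j * b' \<le> (j + K) * b"
      by (simp add: mult.assoc del: mult_Suc)
    then have "j * b' \<le> j * (4 ^ K * card (msums (add_mset a B)))"
      using 1 unfolding b_def by (rule le_trans)
    then have "b' \<le> 4 ^ K * card (msums (add_mset a B))"
      using step.hyps K by simp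
    then show ?case
      using sub B(2) by (intro exI[of _ "add_mset a B"]) (simp add: b'_def)
  qed
  from this[of t] obtain B where "B \<subseteq># A" "(t + K) choose K \<le> 4 ^ K * card (msums B)"
    using K by auto
  then have "(t + K) choose K \<le> 4 ^ K * card (msums A)"
    using card_msums_mono by (metis mult_le_mono2 le_trans)
  then show False
    using small by simp
qed

text \<open>A good block \<open>B\<close> gives every remaining \<open>a\<close> a progression of
  about \<open>size B / K\<close> steps. Progressions with the same difference in disjoint blocks
  add up to a longer one, so blocks are removed until \<open>l\<close> steps are reached. A block
  giving \<open>s\<close> steps costs at most \<open>2 * K * s\<close> elements; only the last can
  overshoot, and it costs at most \<open>t\<close>. The choice of \<open>E\<close> does not depend
  on \<open>a\<close>.\<close>

lemma extract_AP:
  assumes K: "1 \<le> K" "K \<le> t"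
    and "2 * K * l + t \<le> size A" "4 ^ K * card (msums A) < (t + K) choose K"
  shows "\<exists>E. E \<subseteq># A \<and> size E \<le> 2 * K * l + t \<and> (\<forall>a\<in>#A - E. \<exists>x. \<forall>i\<le>l. x + i * a \<in> msums E)"
  using assms(3,4)
proof (induction l arbitrary: A rule: less_induct)
  case (less l)
  obtain B where B: "B \<subseteq># A" "K \<le> size B" "size B \<le> t"
    and bd: "\<And>a. a \<in># A - B \<Longrightarrow> card ((+) a ` msums B - msums B) * size B < K * card (msums B)"
    using polynomial_growth_block[OF K, of A] less.prems by auto
  define s where "s = size B div K"
  have s: "1 \<le> s" "s * K \<le> size B" "size B \<le> 2 * K * s"
  proof -
    show 1: "1 \<le> s"
      using B(2) K by (simp add: s_def Suc_le_eq div_greater_zero_iff)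
    show "s * K \<le> size B"
      by (simp add: s_def)
    have "size B < K * Suc s"
      using K by (simp add: s_def dividend_less_times_div)
    also have "\<dots> \<le> K * (2 * s)"
      using 1 by (intro mult_left_mono) auto
    finally show "size B \<le> 2 * K * s" by (simp add: algebra_simps)
  qed
  have AP: "\<exists>x. \<forall>i\<le>s. x + i * a \<in> msums B" if "a \<in># A - B" for a
  proof (rule AP_of_small_boundary)
    have "s * K * card ((+) a ` msums B - msums B) \<le> card ((+) a ` msums B - msums B) * size B"
      using s(2) by simp
    also have "\<dots> < K * card (msums B)"
      by (rule bd[OF that])
    finally show "s * card ((+) a ` msums B - msums B) < card (msums B)"
      using K by (simp add: mult.commute mult.left_commute)
  qed simp
  show ?case
  proof (cases "l \<le> s")
    case True
    then show ?thesis
      using B AP le_trans by (intro exI[of _ B]) (meson le_add2)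
  next
    case False
    then have ls: "l - s < l" "l = s + (l - s)"
      using s by auto
    have l: "2 * K * l = 2 * K * s + 2 * K * (l - s)"
      using ls(2) by (metis distrib_left)
    have sz: "size (A - B) = size A - size B"
      using B(1) by (rule size_Diff_submset)
    have "card (msums (A - B)) \<le> card (msums A)"
      by (simp add: card_msums_mono)
    then have "4 ^ K * card (msums (A - B)) < (t + K) choose K"
      using less.prems(2) by (meson le_less_trans mult_le_mono2)
    moreover have "2 * K * (l - s) + t \<le> size (A - B)"
      using less.prems(1) sz l s(3) by linarith
    ultimately obtain E where E: "E \<subseteq># A - B" "size E \<le> 2 * K * (l - s) + t"
      and EAP: "\<And>a. a \<in># A - B - E \<Longrightarrow> \<exists>x. \<forall>i\<le>l - s. x + i * a \<in> msums E"
      using less.IH[OF ls(1), of "A - B"] by blast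
    have "\<exists>x. \<forall>i\<le>l. x + i * a \<in> msums (B + E)" if a: "a \<in># A - (B + E)" for a
    proof -
      obtain y where y: "\<And>i. i \<le> l - s \<Longrightarrow> y + i * a \<in> msums E"
        using EAP[of a] a by auto
      have "a \<in># A - B"
        using a by (metis diff_diff_add in_diffD)
      then obtain x where x: "\<And>i. i \<le> s \<Longrightarrow> x + i * a \<in> msums B"
        using AP by blast
      have "x + y + i * a \<in> msums (B + E)" if il: "i \<le> l" for i
      proof -
        obtain p q where pq: "i = p + q" "p \<le> s" "q \<le> l - s"
          using il by (intro that[of "min i s" "i - min i s"]) auto
        have "(x + p * a) + (y + q * a) \<in> msums (B + E)"
          using pq by (intro msums_union x y)
        then show ?thesis
          by (simp add: pq(1) algebra_simps)
      qed
      then show ?thesis by blast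
    qed
    moreover have "B + E \<subseteq># A"
      using B(1) E(1) by (simp add: subset_mset.le_diff_conv2 add.commute)
    moreover have "size (B + E) \<le> 2 * K * l + t"
      using E(2) l s(3) by simp
    ultimately show ?thesis by blast
  qed
qed

text \<open>Several disjoint blocks are needed so that different differences can each use their own.
  Removing a block does not increase the number of subset sums, so \<open>extract_AP\<close> can be
  repeated.\<close>

lemma extract_APs:
  assumes K: "1 \<le> K" "K \<le> t"
    and "G * (2 * K * l + t) \<le> size A" "4 ^ K * card (msums A) < (t + K) choose K"
  shows "\<exists>E. (\<Sum>j<G. E j) \<subseteq># A \<and> size (\<Sum>j<G. E j) \<le> G * (2 * K * l + t) \<and>
    (\<forall>a\<in>#A - (\<Sum>j<G. E j). \<forall>j<G. \<exists>x. \<forall>i\<le>l. x + i * a \<in> msums (E j))"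
  using assms(3,4)
proof (induction G)
  case 0
  then show ?case by simp
next
  case (Suc G)
  then obtain E where E: "(\<Sum>j<G. E j) \<subseteq># A" "size (\<Sum>j<G. E j) \<le> G * (2 * K * l + t)"
    and AP: "\<And>a j. a \<in># A - (\<Sum>j<G. E j) \<Longrightarrow> j < G \<Longrightarrow> \<exists>x. \<forall>i\<le>l. x + i * a \<in> msums (E j)"
    by auto
  define F where "F = (\<Sum>j<G. E j)"
  have "card (msums (A - F)) \<le> card (msums A)"
    by (simp add: card_msums_mono)
  then have "4 ^ K * card (msums (A - F)) < (t + K) choose K"
    using Suc.prems(2) by (meson le_less_trans mult_le_mono2)
  moreover have "2 * K * l + t \<le> size (A - F)"
    using E Suc.prems(1) by (simp add: F_def size_Diff_submset)
  ultimately obtain B where B: "B \<subseteq># A - F" "size B \<le> 2 * K * l + t"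
    and BAP: "\<And>a. a \<in># A - F - B \<Longrightarrow> \<exists>x. \<forall>i\<le>l. x + i * a \<in> msums B"
    using extract_AP[OF K, of l "A - F"] by blast
  define E' where "E' = E(G := B)"
  have sum: "(\<Sum>j<Suc G. E' j) = F + B"
    by (simp add: E'_def F_def)
  have "\<exists>x. \<forall>i\<le>l. x + i * a \<in> msums (E' j)" if a: "a \<in># A - (F + B)" and j: "j < Suc G" for a j
  proof (cases "j = G")
    case True
    then show ?thesis
      using BAP[of a] a by (simp add: E'_def)
  next
    case False
    have "a \<in># A - F"
      using a by (metis diff_diff_add in_diffD)
    then show ?thesis
      using AP[of a j] False j by (auto simp: E'_def F_def)
  qed
  moreover have "F + B \<subseteq># A"
    using B(1) E(1) by (simp add: subset_mset.le_diff_conv2 add.commute F_def)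
  moreover have "size (F + B) \<le> Suc G * (2 * K * l + t)"
    using E(2) B(2) by (simp add: F_def)
  ultimately show ?case
    unfolding sum[symmetric] by blast
qed

lemma msums_sum:
  assumes "finite I" "\<And>i. i \<in> I \<Longrightarrow> x i \<in> msums (E i)"
  shows "(\<Sum>i\<in>I. x i) \<in> msums (\<Sum>i\<in>I. E i)"
  using assms by (induction I) (auto intro: msums_union)

definition contains_box :: "nat set \<Rightarrow> nat set \<Rightarrow> nat \<Rightarrow> bool" where
  "contains_box X T l \<longleftrightarrow> (\<exists>x. \<forall>c. (\<forall>d\<in>T. c d \<le> l) \<longrightarrow> x + (\<Sum>d\<in>T. c d * d) \<in> X)"

text \<open>An injection \<open>h\<close> assigns to each direction its own block; adding the
  progressions found in these blocks gives the box. One \<open>E\<close> serves all sets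
  \<open>T\<close> at once.\<close>

lemma extract_GAP:
  assumes K: "1 \<le> K" "K \<le> t"
    and "G * (2 * K * l + t) \<le> size A" "4 ^ K * card (msums A) < (t + K) choose K"
  shows "\<exists>E. E \<subseteq># A \<and> size E \<le> G * (2 * K * l + t) \<and>
    (\<forall>T. T \<subseteq> set_mset (A - E) \<and> card T \<le> G \<longrightarrow> contains_box (msums E) T l)"
proof -
  obtain E where E: "(\<Sum>j<G. E j) \<subseteq># A" "size (\<Sum>j<G. E j) \<le> G * (2 * K * l + t)"
    and AP: "\<And>a j. a \<in># A - (\<Sum>j<G. E j) \<Longrightarrow> j < G \<Longrightarrow> \<exists>x. \<forall>i\<le>l. x + i * a \<in> msums (E j)"
    using extract_APs[OF assms] by blast
  have "contains_box (msums (\<Sum>j<G. E j)) T l"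
    if T: "T \<subseteq> set_mset (A - (\<Sum>j<G. E j))" "card T \<le> G" for T
  proof -
    have fin: "finite T"
      using T(1) finite_subset by blast
    obtain h where h: "inj_on h T" "h ` T \<subseteq> {..<G}"
      using T(2) fin by (metis card_lessThan finite_lessThan inj_on_iff_card_le)
    have "\<exists>y. \<forall>i\<le>l. y + i * d \<in> msums (E (h d))" if "d \<in> T" for d
      using AP[of d "h d"] h(2) that T(1) by blast
    then obtain y where y: "\<And>d i. d \<in> T \<Longrightarrow> i \<le> l \<Longrightarrow> y d + i * d \<in> msums (E (h d))"
      by metis
    have "(\<Sum>d\<in>T. y d) + (\<Sum>d\<in>T. c d * d) \<in> msums (\<Sum>j<G. E j)" if "\<forall>d\<in>T. c d \<le> l" for c
    proof -
      have "(\<Sum>d\<in>T. y d + c d * d) \<in> msums (\<Sum>d\<in>T. E (h d))"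
        using that by (intro msums_sum fin y) auto
      also have "(\<Sum>d\<in>T. E (h d)) = (\<Sum>j\<in>h ` T. E j)"
        using h(1) by (simp add: sum.reindex)
      also have "msums \<dots> \<subseteq> msums (\<Sum>j<G. E j)"
      proof (rule msums_mono)
        have "(\<Sum>j<G. E j) = (\<Sum>j\<in>h ` T. E j) + (\<Sum>j\<in>{..<G} - h ` T. E j)"
          using sum.subset_diff[OF h(2), of E] by (simp add: add.commute)
        then show "(\<Sum>j\<in>h ` T. E j) \<subseteq># (\<Sum>j<G. E j)"
          by simp
      qed
      finally show ?thesis
        by (simp add: sum.distrib)
    qed
    then show ?thesis
      unfolding contains_box_def by blast
  qed
  then show ?thesis
    using E by blast
qed

section \<open>Short directions from linear relations\<close>

text \<open>Dirichlet's argument for the fractions \<open>c d / H\<close>: the \<open>H\<close>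
  multiples \<open>z\<close> fall into fewer than \<open>H\<close> cells, and the difference of two
  multiples in the same cell is the denominator \<open>q\<close>.\<close>

lemma simultaneous_approximation:
  fixes c :: "'i \<Rightarrow> int"
  assumes J: "finite J" and s: "1 \<le> s" "int s ^ card J < H"
  shows "\<exists>q u. 0 < q \<and> q < H \<and> (\<forall>d\<in>J. int s * \<bar>H * u d - q * c d\<bar> < H)"
proof -
  have H: "0 < H"
    using s by (smt (verit) zero_le_power of_nat_0_le_iff)
  \<comment> \<open>For each \<open>d\<close> this records which of the \<open>s\<close> intervals
    of length \<open>H / s\<close> contains \<open>z * c d\<close> modulo \<open>H\<close>.\<close>
  define \<phi> where "\<phi> z = restrict (\<lambda>d. (int s * ((z * c d) mod H)) div H) J" for z
  have "\<phi> ` {0..<H} \<subseteq> PiE J (\<lambda>_. {0..<int s})"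
  proof -
    have "0 \<le> (int s * (x mod H)) div H \<and> (int s * (x mod H)) div H < int s" for x
    proof -
      have "int s * (x mod H) < int s * H"
        using H s by simp
      moreover have "0 \<le> int s * (x mod H)"
        using H by simp
      moreover have "H * (int s * (x mod H) div H) \<le> int s * (x mod H)"
        using H by (metis minus_mod_eq_mult_div diff_le_eq le_add_same_cancel1 pos_mod_sign)
      ultimately show ?thesis
        using H by (smt (verit) mult.commute mult_less_cancel_right_disj pos_imp_zdiv_nonneg_iff mult_right_mono)
    qed
    then show ?thesis by (auto simp: \<phi>_def)
  qed
  then have "card (\<phi> ` {0..<H}) \<le> card (PiE J (\<lambda>_. {0..<int s}))"
    using J by (intro card_mono finite_PiE) auto
  also have "\<dots> = s ^ card J"
    using J by (simp add: card_PiE)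
  also have "\<dots> < card {0..<H}"
    using s(2) H by simp (metis nat_less_iff of_nat_power zero_le_power of_nat_0_le_iff zless_nat_eq_int_zless)
  finally have "\<not> inj_on \<phi> {0..<H}"
    by (rule pigeonhole)
  then obtain y z where yz: "y \<in> {0..<H}" "z \<in> {0..<H}" "\<phi> y = \<phi> z" "y < z"
    unfolding inj_on_def by (metis linorder_less_linear)
  have "int s * \<bar>H * ((z * c d) div H - (y * c d) div H) - (z - y) * c d\<bar> < H" if "d \<in> J" for d
  proof -
    define e where "e x = (x * c d) mod H" for x
    have e: "x * c d = H * ((x * c d) div H) + e x" for x
      by (simp add: e_def)
    have "(int s * e y) div H = (int s * e z) div H"
      using fun_cong[OF yz(3), of d] that by (simp add: \<phi>_def e_def)
    then have "\<bar>int s * e y - int s * e z\<bar> < H"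
      using H by (smt (verit) mult_div_mod_eq pos_mod_bound pos_mod_sign)
    then have "int s * \<bar>e y - e z\<bar> < H"
      by (simp add: abs_mult flip: right_diff_distrib)
    moreover have "H * ((z * c d) div H - (y * c d) div H) - (z - y) * c d = e y - e z"
      using e[of y] e[of z] by (simp add: algebra_simps)
    ultimately show ?thesis by simp
  qed
  then show ?thesis
    using yz by (intro exI[of _ "z - y"] exI[of _ "\<lambda>d. (z * c d) div H - (y * c d) div H"]) auto
qed

section \<open>Relations over a dissociated set\<close>

text \<open>For \<open>M = 1\<close> this is the usual notion. Allowing coefficients of both signs
  up to \<open>M\<close> makes all sums with coefficients in \<open>{0..M}\<close> distinct.\<close>

definition dissociated :: "nat \<Rightarrow> nat set \<Rightarrow> bool" where
  "dissociated M D \<longleftrightarrow> (\<forall>c :: nat \<Rightarrow> int.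
     (\<forall>d\<in>D. \<bar>c d\<bar> \<le> int M) \<and> (\<Sum>d\<in>D. c d * int d) = 0 \<longrightarrow> (\<forall>d\<in>D. c d = 0))"

text \<open>The number \<open>c a\<close> divides every \<open>u a * c d\<close>, hence
  \<open>u a\<close> times the gcd of all \<open>c d\<close>, which is \<open>u a\<close> itself. So
  the ratio of the two vectors is an integer.\<close>

lemma proportional_to_primitive:
  fixes c u :: "'i \<Rightarrow> int"
  assumes "Gcd (c ` T) = 1" "a \<in> T" "c a \<noteq> 0" "\<And>d. d \<in> T \<Longrightarrow> c a * u d = u a * c d"
  shows "\<exists>q. \<forall>d\<in>T. u d = q * c d"
proof -
  have "c a dvd Gcd ((*) (u a) ` (c ` T))"
  proof (rule Gcd_greatest)
    fix b assume "b \<in> (*) (u a) ` (c ` T)"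
    then obtain d where "d \<in> T" "b = u a * c d"
      by blast
    then show "c a dvd b"
      using assms(4) by (metis dvd_triv_left)
  qed
  then have "c a dvd u a"
    using assms(1) by (simp add: Gcd_mult)
  then obtain q where q: "u a = c a * q" ..
  then have "u d = q * c d" if "d \<in> T" for d
    using assms(3) assms(4)[OF that] by simp
  then show ?thesis by blast
qed

text \<open>The coefficient vector \<open>u\<close> of \<open>w\<close> is an integer approximation of \<open>(q / H) c\<close> for some
  \<open>0 < q < H\<close>, so \<open>k u\<close> becomes small after subtracting a suitable multiple of the relation \<open>c\<close>.
  If \<open>w\<close> were \<open>0\<close>, eliminating \<open>a\<close> from the relations \<open>u\<close> and \<open>c\<close> would give a short relation on
  the dissociated set \<open>T - {a}\<close>, which must be trivial; so \<open>u\<close> would be a rational, and by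
  primitivity an integer, multiple of \<open>c\<close>, contradicting \<open>0 < q < H\<close>.\<close>

lemma short_direction_aux:
  fixes c :: "nat \<Rightarrow> int"
  assumes T: "finite T" and rel: "(\<Sum>d\<in>T. c d * int d) = 0" and prim: "Gcd (c ` T) = 1"
    and p: "p \<in> T" "c p = H" and max: "\<And>d. d \<in> T \<Longrightarrow> \<bar>c d\<bar> \<le> H" and HM: "H \<le> int M"
    and a: "a \<in> T" "c a \<noteq> 0" "dissociated M (T - {a})"
    and s: "2 \<le> s" "int s ^ (card T - 1) < H"
  shows "\<exists>w. w \<noteq> 0 \<and> (\<forall>k\<ge>0. \<exists>v. (\<forall>d\<in>T. int s * \<bar>v d\<bar> \<le> k + int s * H) \<and>
    k * w = (\<Sum>d\<in>T. v d * int d))"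
proof -
  have H: "0 < H"
    using s by (smt (verit) zero_le_power of_nat_0_le_iff)
  have "int s ^ card (T - {p}) < H"
    using s(2) p(1) T by simp
  then obtain q u0 where q: "0 < q" "q < H"
    and u0: "\<And>d. d \<in> T - {p} \<Longrightarrow> int s * \<bar>H * u0 d - q * c d\<bar> < H"
    using simultaneous_approximation[of "T - {p}" s H c] T s(1) by auto
  \<comment> \<open>Since \<open>c p = H\<close>, the coordinate \<open>p\<close> is approximated
    without error by \<open>q\<close>. This is why only \<open>card T - 1\<close> coordinates enter
    the pigeonhole count.\<close>
  define u where "u = u0(p := q)"
  have up: "u p = q"
    by (simp add: u_def)
  define e where "e d = H * u d - q * c d" for d
  have e: "int s * \<bar>e d\<bar> < H" if "d \<in> T" for d
    using u0[of d] that p(2) H by (cases "d = p") (auto simp: e_def u_def)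
  define w where "w = (\<Sum>d\<in>T. u d * int d)"
  have "w \<noteq> 0"
  proof
    assume w0: "w = 0"
    define y where "y d = c a * u d - u a * c d" for d
    have Hy: "H * y d = c a * e d - c d * e a" for d
      by (simp add: y_def e_def algebra_simps)
    \<comment> \<open>The two error terms contribute at most \<open>H / s\<close> each, and
      \<open>s\<close> is at least \<open>2\<close>.\<close>
    have "\<bar>y d\<bar> \<le> H" if "d \<in> T" for d
    proof -
      have "int s * (H * \<bar>y d\<bar>) = int s * \<bar>c a * e d - c d * e a\<bar>"
        using H by (simp add: abs_mult flip: Hy)
      also have "\<dots> \<le> int s * (\<bar>c a\<bar> * \<bar>e d\<bar> + \<bar>c d\<bar> * \<bar>e a\<bar>)"
        by (intro mult_left_mono) (metis abs_triangle_ineq4 abs_mult, simp)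
      also have "\<dots> = \<bar>c a\<bar> * (int s * \<bar>e d\<bar>) + \<bar>c d\<bar> * (int s * \<bar>e a\<bar>)"
        by (simp add: algebra_simps)
      also have "\<dots> \<le> H * H + H * H"
        using max[OF that] max[OF a(1)] e[OF that] e[OF a(1)] H
        by (intro add_mono mult_mono) auto
      also have "\<dots> \<le> int s * (H * H)"
        using s(1) H by (simp add: mult_right_mono flip: mult_2)
      finally show ?thesis
        using s(1) H by simp
    qed
    moreover have "(\<Sum>d\<in>T - {a}. y d * int d) = 0"
    proof -
      have "(\<Sum>d\<in>T. y d * int d) = c a * w - u a * (\<Sum>d\<in>T. c d * int d)"
        by (simp add: y_def w_def sum_distrib_left sum_subtractf algebra_simps)
      then have "(\<Sum>d\<in>T. y d * int d) = 0"
        using w0 rel by simp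
      moreover have "y a = 0"
        by (simp add: y_def)
      ultimately show ?thesis
        using T a(1) by (simp add: sum.remove)
    qed
    ultimately have "\<forall>d\<in>T - {a}. y d = 0"
      using a(3) HM unfolding dissociated_def by (meson DiffD1 order_trans)
    then have "c a * u d = u a * c d" if "d \<in> T" for d
      using that by (cases "d = a") (auto simp: y_def)
    then obtain m where "\<forall>d\<in>T. u d = m * c d"
      using proportional_to_primitive[OF prim a(1,2), of u] by blast
    then have "q = m * H"
      using p up by auto
    then show False
      using q H by (smt (verit) mult_le_cancel_right1 mult_nonpos_nonneg zero_less_mult_pos2)
  qed
  moreover have "\<exists>v. (\<forall>d\<in>T. int s * \<bar>v d\<bar> \<le> k + int s * H) \<and> k * w = (\<Sum>d\<in>T. v d * int d)"
    if k: "0 \<le> k" for k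
  proof -
    \<comment> \<open>As \<open>H * u\<close> is close to \<open>q * c\<close>, the nearest
      multiples of \<open>c\<close> to \<open>k * u\<close> have factor about
      \<open>k * q / H\<close>. Rounding down leaves \<open>k * e d + r * c d\<close> over
      \<open>H\<close>, that is at most \<open>k / s\<close> from the approximation and
      \<open>H\<close> from the remainder.\<close>
    define m where "m = (k * q) div H"
    define r where "r = (k * q) mod H"
    have r: "0 \<le> r" "r < H" "k * q = m * H + r"
      using H by (auto simp: m_def r_def)
    define v where "v d = k * u d - m * c d" for d
    have "int s * \<bar>v d\<bar> \<le> k + int s * H" if d: "d \<in> T" for d
    proof -
      have "H * v d = k * (H * u d) - (m * H) * c d"
        by (simp add: v_def algebra_simps)
      also have "\<dots> = k * e d + (k * q - m * H) * c d"
        by (simp add: e_def algebra_simps)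
      also have "\<dots> = k * e d + r * c d"
        using r(3) by simp
      finally have Hv: "H * v d = k * e d + r * c d" .
      have "H * (int s * \<bar>v d\<bar>) = int s * \<bar>k * e d + r * c d\<bar>"
        using H by (simp add: abs_mult flip: Hv)
      also have "\<dots> \<le> int s * (\<bar>k * e d\<bar> + \<bar>r * c d\<bar>)"
        by (intro mult_left_mono abs_triangle_ineq) simp
      also have "\<dots> = k * (int s * \<bar>e d\<bar>) + int s * (r * \<bar>c d\<bar>)"
        using k r(1) by (simp add: abs_mult algebra_simps)
      also have "\<dots> \<le> k * H + int s * (H * H)"
        using k r e[OF d] max[OF d] by (intro add_mono mult_mono mult_left_mono) auto
      also have "\<dots> = H * (k + int s * H)"
        by (simp add: algebra_simps)
      finally show ?thesis
        using H by simp
    qed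
    moreover have "(\<Sum>d\<in>T. v d * int d) = k * w - m * (\<Sum>d\<in>T. c d * int d)"
      by (simp add: v_def w_def sum_distrib_left sum_subtractf algebra_simps)
    ultimately show ?thesis
      using rel by (intro exI[of _ v]) auto
  qed
  ultimately show ?thesis by blast
qed

text \<open>Every multiple \<open>k * w\<close> has coefficients of size at most
  \<open>k / s + M\<close>, so \<open>s * l1\<close> steps in direction \<open>w\<close> need only
  half-side \<open>l1 + M\<close>. The condition is multiplied by \<open>s\<close> to stay in the
  integers.\<close>

definition short_dir :: "nat \<Rightarrow> nat \<Rightarrow> nat set \<Rightarrow> int \<Rightarrow> bool" where
  "short_dir s M T w \<longleftrightarrow> (\<forall>k\<ge>0. \<exists>v. (\<forall>d\<in>T. int s * \<bar>v d\<bar> \<le> k + int s * int M) \<and>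
     k * w = (\<Sum>d\<in>T. v d * int d))"

text \<open>Multiplying the relation by the sign of its largest coefficient makes that coefficient
  positive, as \<open>short_direction_aux\<close> requires; the bound in terms of it is then relaxed
  to \<open>M\<close>.\<close>

lemma short_direction:
  fixes c :: "nat \<Rightarrow> int"
  assumes "finite T" "(\<Sum>d\<in>T. c d * int d) = 0" "Gcd (c ` T) = 1"
    and "p \<in> T" "\<And>d. d \<in> T \<Longrightarrow> \<bar>c d\<bar> \<le> \<bar>c p\<bar>" "\<bar>c p\<bar> \<le> int M"
    and "a \<in> T" "c a \<noteq> 0" "dissociated M (T - {a})"
    and "2 \<le> s" "int s ^ (card T - 1) < \<bar>c p\<bar>"
  shows "\<exists>w. w \<noteq> 0 \<and> short_dir s M T w"
proof -
  define b where "b d = sgn (c p) * c d" for d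
  have cp: "c p \<noteq> 0"
    using assms(11) by (smt (verit) zero_le_power of_nat_0_le_iff)
  have babs: "\<bar>b d\<bar> = \<bar>c d\<bar>" for d
    using cp by (simp add: b_def abs_mult)
  have "(\<Sum>d\<in>T. b d * int d) = sgn (c p) * (\<Sum>d\<in>T. c d * int d)"
    by (simp add: b_def sum_distrib_left mult.assoc)
  then have 1: "(\<Sum>d\<in>T. b d * int d) = 0"
    using assms(2) by simp
  have "b ` T = (*) (sgn (c p)) ` (c ` T)"
    by (auto simp: b_def)
  then have 2: "Gcd (b ` T) = 1"
    using assms(3) cp by (simp add: Gcd_mult)
  have 3: "b p = \<bar>c p\<bar>"
    by (simp add: b_def abs_sgn mult.commute)
  have 4: "b a \<noteq> 0"
    using cp assms(8) by (simp add: b_def sgn_eq_0_iff)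
  obtain w where w: "w \<noteq> 0"
    and v: "\<And>k. k \<ge> 0 \<Longrightarrow> \<exists>v. (\<forall>d\<in>T. int s * \<bar>v d\<bar> \<le> k + int s * \<bar>c p\<bar>) \<and>
      k * w = (\<Sum>d\<in>T. v d * int d)"
    using short_direction_aux[OF assms(1) 1 2 assms(4) 3 _ assms(6,7) 4 assms(9,10,11)] assms(5) babs
    by auto
  have le: "int s * \<bar>c p\<bar> \<le> int s * int M"
    using assms(6) by (rule mult_left_mono) simp
  have "\<exists>v. (\<forall>d\<in>T. int s * \<bar>v d\<bar> \<le> k + int s * int M) \<and> k * w = (\<Sum>d\<in>T. v d * int d)"
    if "k \<ge> 0" for k
    using v[OF that] le by (meson add_left_mono order_trans)
  then show ?thesis
    using w unfolding short_dir_def by blast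
qed

text \<open>A nontrivial short relation on \<open>insert a D\<close> must involve \<open>a\<close>,
  because \<open>D\<close> is dissociated. Dividing by the gcd makes it primitive and keeps it
  short.\<close>

lemma primitive_relation:
  fixes M :: nat
  assumes D: "finite D" "dissociated M D" and a: "a \<notin> D" "\<not> dissociated M (insert a D)"
  shows "\<exists>c :: nat \<Rightarrow> int. (\<forall>d\<in>insert a D. \<bar>c d\<bar> \<le> int M) \<and> (\<Sum>d\<in>insert a D. c d * int d) = 0 \<and>
    c a \<noteq> 0 \<and> Gcd (c ` insert a D) = 1"
proof -
  define T where "T = insert a D"
  obtain b :: "nat \<Rightarrow> int" where b: "\<forall>d\<in>T. \<bar>b d\<bar> \<le> int M" "(\<Sum>d\<in>T. b d * int d) = 0"
    and nz: "\<exists>d\<in>T. b d \<noteq> 0"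
    using a(2) unfolding dissociated_def T_def by blast
  have ba: "b a \<noteq> 0"
  proof
    assume b0: "b a = 0"
    then have "(\<Sum>d\<in>D. b d * int d) = 0"
      using b(2) D(1) a(1) by (simp add: T_def)
    then have "\<forall>d\<in>D. b d = 0"
      using D(2) b(1) unfolding dissociated_def T_def by blast
    then show False
      using nz b0 by (auto simp: T_def)
  qed
  define g where "g = Gcd (b ` T)"
  have gdvd: "g dvd b d" if "d \<in> T" for d
    using that by (simp add: g_def)
  have g: "0 < g"
    using gdvd[of a] ba by (smt (verit) Gcd_int_greater_eq_0 T_def dvd_0_left_iff g_def insertI1)
  define c where "c d = b d div g" for d
  have bc: "b d = g * c d" if "d \<in> T" for d
    using gdvd[OF that] by (simp add: c_def)
  have "\<bar>c d\<bar> \<le> int M" if "d \<in> T" for d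
  proof -
    have "\<bar>c d\<bar> \<le> \<bar>b d\<bar>"
      using bc[OF that] g by (simp add: abs_mult mult_le_cancel_right1)
    then show ?thesis
      using b(1) that by fastforce
  qed
  moreover have "g * (\<Sum>d\<in>T. c d * int d) = (\<Sum>d\<in>T. b d * int d)"
    by (simp add: bc sum_distrib_left mult.assoc cong: sum.cong)
  then have "(\<Sum>d\<in>T. c d * int d) = 0"
    using b(2) g by simp
  moreover have "c a \<noteq> 0"
    using bc[of a] ba by (auto simp: T_def)
  moreover have "Gcd (c ` T) = 1"
  proof -
    have "b ` T = (*) g ` (c ` T)"
      using bc by (auto simp: image_iff)
    then have "Gcd (b ` T) = g * Gcd (c ` T)"
      using g by (simp only: Gcd_mult normalize_mult) simp
    then have "g = g * Gcd (c ` T)"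
      by (simp only: g_def)
    then show ?thesis
      using g by simp
  qed
  ultimately show ?thesis
    unfolding T_def by blast
qed

text \<open>The coefficients determine \<open>a\<close>, since the relation can be solved for it.
  Hence many distinct elements cannot all have relations with small coefficients.\<close>

lemma card_le_of_small_relations:
  fixes c :: "nat \<Rightarrow> nat \<Rightarrow> int"
  assumes D: "finite D" and disj: "Q \<inter> D = {}"
    and c: "\<And>a d. a \<in> Q \<Longrightarrow> d \<in> insert a D \<Longrightarrow> \<bar>c a d\<bar> \<le> int h"
    and rel: "\<And>a. a \<in> Q \<Longrightarrow> (\<Sum>d\<in>insert a D. c a d * int d) = 0" and nz: "\<And>a. a \<in> Q \<Longrightarrow> c a a \<noteq> 0"
  shows "card Q \<le> (2 * h + 1) ^ (card D + 1)"
proof -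
  define I where "I = {- int h..int h}"
  define \<phi> where "\<phi> a = (c a a, restrict (c a) D)" for a
  have "inj_on \<phi> Q"
  proof (rule inj_onI)
    fix a b assume ab: "a \<in> Q" "b \<in> Q" "\<phi> a = \<phi> b"
    have eq: "c x x * int x = - (\<Sum>d\<in>D. c x d * int d)" if "x \<in> Q" for x
    proof -
      have "x \<notin> D"
        using that disj by blast
      then show ?thesis
        using rel[OF that] D by simp
    qed
    have "c a d = c b d" if "d \<in> D" for d
      using ab(3) that by (auto simp: \<phi>_def dest: fun_cong[where x = d])
    then have "c a a * int a = c b b * int b"
      using eq[OF ab(1)] eq[OF ab(2)] by simp
    then show "a = b"
      using ab nz by (simp add: \<phi>_def)
  qed
  moreover have "\<phi> ` Q \<subseteq> I \<times> PiE D (\<lambda>_. I)"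
    using c by (fastforce simp: \<phi>_def I_def abs_le_iff)
  moreover have "finite (I \<times> PiE D (\<lambda>_. I))"
    using D by (auto simp: I_def intro!: finite_PiE)
  ultimately have "card Q \<le> card (I \<times> PiE D (\<lambda>_. I))"
    by (rule card_inj_on_le)
  also have "\<dots> = (2 * h + 1) ^ (card D + 1)"
  proof -
    have "card I = 2 * h + 1"
      by (simp add: I_def)
    then show ?thesis
      using D by (simp add: card_cartesian_product card_PiE)
  qed
  finally show ?thesis .
qed

lemma ex_maximum:
  fixes f :: "'i \<Rightarrow> 'b::linorder"
  assumes "finite S" "S \<noteq> {}"
  shows "\<exists>x\<in>S. \<forall>y\<in>S. f y \<le> f x"
proof -
  have "Max (f ` S) \<in> f ` S"
    using assms by (intro Max_in) auto
  then obtain x where "x \<in> S" "Max (f ` S) = f x"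
    by blast
  then show ?thesis
    using assms(1) by (metis Max_ge finite_imageI imageI)
qed

text \<open>Over a dissociated set \<open>D\<close> of maximum size, every other element of
  \<open>R\<close> satisfies a primitive relation with coefficients up to \<open>M\<close>. There
  are too many elements for all these coefficients to stay below the threshold, so some relation is
  long enough for \<open>short_direction\<close>.\<close>

lemma ex_short_direction:
  fixes R :: "nat set"
  assumes R: "finite R" and dim: "\<And>D. D \<subseteq> R \<Longrightarrow> dissociated M D \<Longrightarrow> card D \<le> r"
    and s: "2 \<le> s" and many: "r + (2 * s ^ r + 1) ^ (r + 1) < card R"
  shows "\<exists>T w. T \<subseteq> R \<and> card T \<le> r + 1 \<and> w \<noteq> 0 \<and>
    short_dir s M T w"
proof -
  have "{} \<in> {D. D \<subseteq> R \<and> dissociated M D}"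
    by (simp add: dissociated_def)
  then have "{D. D \<subseteq> R \<and> dissociated M D} \<noteq> {}"
    by blast
  moreover have "finite {D. D \<subseteq> R \<and> dissociated M D}"
    using R by simp
  ultimately obtain D where D: "D \<subseteq> R" "dissociated M D"
    and maxD: "\<And>D'. D' \<subseteq> R \<Longrightarrow> dissociated M D' \<Longrightarrow> card D' \<le> card D"
    using ex_maximum[of "{D. D \<subseteq> R \<and> dissociated M D}" card] by auto
  have finD: "finite D"
    using D(1) R finite_subset by blast
  have rD: "card D \<le> r"
    using dim D by blast
  \<comment> \<open>This threshold is what Dirichlet's argument needs for
    \<open>T = insert a D\<close>, where \<open>card T - 1 = card D\<close>.\<close>
  define h where "h = s ^ card D"
  have "\<exists>c. (\<forall>d\<in>insert a D. \<bar>c d\<bar> \<le> int M) \<and> (\<Sum>d\<in>insert a D. c d * int d) = 0 \<and>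
    c a \<noteq> 0 \<and> Gcd (c ` insert a D) = 1" if "a \<in> R - D" for a
  proof (rule primitive_relation[OF finD D(2)])
    show "\<not> dissociated M (insert a D)"
      using maxD[of "insert a D"] that D(1) finD by auto
  qed (use that in auto)
  then obtain c :: "nat \<Rightarrow> nat \<Rightarrow> int" where c:
    "\<And>a d. a \<in> R - D \<Longrightarrow> d \<in> insert a D \<Longrightarrow> \<bar>c a d\<bar> \<le> int M"
    "\<And>a. a \<in> R - D \<Longrightarrow> (\<Sum>d\<in>insert a D. c a d * int d) = 0"
    "\<And>a. a \<in> R - D \<Longrightarrow> c a a \<noteq> 0"
    "\<And>a. a \<in> R - D \<Longrightarrow> Gcd (c a ` insert a D) = 1"
    by metis
  have "\<exists>a\<in>R - D. \<exists>d\<in>insert a D. \<bar>c a d\<bar> > int h"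
  proof (rule ccontr)
    assume "\<not> ?thesis"
    then have "card (R - D) \<le> (2 * h + 1) ^ (card D + 1)"
      using c(2,3) by (intro card_le_of_small_relations[OF finD, of _ c]) (auto simp: not_less)
    also have "\<dots> \<le> (2 * s ^ r + 1) ^ (card D + 1)"
      using s rD by (intro power_mono) (auto simp: h_def intro: power_increasing)
    also have "\<dots> \<le> (2 * s ^ r + 1) ^ (r + 1)"
      using rD by (intro power_increasing) auto
    finally have "card R \<le> r + (2 * s ^ r + 1) ^ (r + 1)"
      using card_Diff_subset[OF finD D(1)] rD by linarith
    then show False
      using many by simp
  qed
  then obtain a d0 where a: "a \<in> R - D" and d0: "d0 \<in> insert a D" "\<bar>c a d0\<bar> > int h"
    by blast
  define T where "T = insert a D"
  have T: "finite T" "T \<noteq> {}" "card T = card D + 1" "T - {a} = D" "T \<subseteq> R"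
    using finD a D(1) by (auto simp: T_def)
  obtain p where p: "p \<in> T" "\<And>d. d \<in> T \<Longrightarrow> \<bar>c a d\<bar> \<le> \<bar>c a p\<bar>"
    using ex_maximum[OF T(1,2), of "\<lambda>d. \<bar>c a d\<bar>"] by blast
  have "int h < \<bar>c a p\<bar>"
    using p(2)[of d0] d0 by (simp add: T_def)
  then have "int s ^ (card T - 1) < \<bar>c a p\<bar>"
    by (simp add: h_def T(3))
  then obtain w where w: "w \<noteq> 0 \<and> short_dir s M T w"
    using a c(1)[OF a] c(2-4)[OF a] p T D(2) s
      short_direction[of T "c a" p M a s] by (auto simp: T_def)
  have "card T \<le> r + 1"
    using T(3) rD by simp
  then show ?thesis
    using w T(5) by (intro exI[of _ T] exI[of _ w]) simp
qed

section \<open>Progressions and dissociated directions inside boxes\<close>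

lemma AP_in_GAP:
  fixes X T :: "nat set"
  assumes T: "finite T" and box: "\<And>c. (\<forall>d\<in>T. c d \<le> l) \<Longrightarrow> x + (\<Sum>d\<in>T. c d * d) \<in> X"
    and w: "w \<noteq> 0" and s: "0 < s" and l: "2 * (l1 + M) \<le> l"
    and dir: "short_dir s M T w"
  shows "\<exists>y d. d > 0 \<and> (\<forall>i\<le>s * l1. y + i * d \<in> X)"
proof -
  \<comment> \<open>The walk starts at a point with all coefficients \<open>l1 + M\<close>, so that
    deviations of either sign up to \<open>l1 + M\<close> stay within \<open>0\<close> and
    \<open>l\<close>.\<close>
  define x0 where "x0 = int x + (\<Sum>d\<in>T. int (l1 + M) * int d)"
  have main: "\<exists>y\<in>X. int y = x0 + int i * w" if i: "i \<le> s * l1" for i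
  proof -
    obtain v where v: "\<And>d. d \<in> T \<Longrightarrow> int s * \<bar>v d\<bar> \<le> int i + int s * int M"
      "int i * w = (\<Sum>d\<in>T. v d * int d)"
      using dir[unfolded short_dir_def, rule_format, of "int i"] by auto
    have b: "\<bar>v d\<bar> \<le> int (l1 + M)" if "d \<in> T" for d
    proof -
      have "int s * \<bar>v d\<bar> \<le> int (s * l1) + int s * int M"
        using v(1)[OF that] i by linarith
      also have "\<dots> = int s * int (l1 + M)"
        by (simp add: algebra_simps)
      finally show ?thesis
        using s by simp
    qed
    define c where "c d = nat (int (l1 + M) + v d)" for d
    have c: "int (c d) = int (l1 + M) + v d" if "d \<in> T" for d
      using b[OF that] by (simp add: c_def)
    have "c d \<le> l" if "d \<in> T" for d
    proof -
      have "int (c d) \<le> int (2 * (l1 + M))"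
        using b[OF that] c[OF that] by simp
      then show ?thesis
        using l by linarith
    qed
    then have "x + (\<Sum>d\<in>T. c d * d) \<in> X"
      by (intro box) simp
    moreover have "int (x + (\<Sum>d\<in>T. c d * d)) = x0 + int i * w"
    proof -
      have "int (\<Sum>d\<in>T. c d * d) = (\<Sum>d\<in>T. int (c d) * int d)"
        by simp
      also have "\<dots> = (\<Sum>d\<in>T. int (l1 + M) * int d + v d * int d)"
        by (intro sum.cong refl) (simp only: c distrib_right)
      finally show ?thesis
        by (simp only: x0_def v(2) sum.distrib of_nat_add add.assoc)
    qed
    ultimately show ?thesis by blast
  qed
  show ?thesis
  proof (cases "w > 0")
    case True
    obtain y where y: "y \<in> X" "int y = x0"
      using main[of 0] by auto
    have "y + i * nat w \<in> X" if i: "i \<le> s * l1" for i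
    proof -
      obtain z where z: "z \<in> X" "int z = x0 + int i * w"
        using main[OF i] by blast
      then have "int z = int (y + i * nat w)"
        using y True by simp
      then show ?thesis
        using z(1) by (metis of_nat_eq_iff)
    qed
    then show ?thesis
      using True by (intro exI[of _ y] exI[of _ "nat w"]) auto
  next
    case False
    \<comment> \<open>For negative \<open>w\<close> the progression is read backwards from its last
      term, to have a positive difference.\<close>
    obtain y where y: "y \<in> X" "int y = x0 + int (s * l1) * w"
      using main[of "s * l1"] by auto
    have "y + i * nat (- w) \<in> X" if "i \<le> s * l1" for i
    proof -
      obtain z where z: "z \<in> X" "int z = x0 + int (s * l1 - i) * w"
        using main[of "s * l1 - i"] by auto
      then have "int z = int (y + i * nat (- w))"
        using y False that by (simp add: of_nat_diff algebra_simps)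
      then show ?thesis
        using z(1) by (metis of_nat_eq_iff)
    qed
    then show ?thesis
      using False w by (intro exI[of _ y] exI[of _ "nat (- w)"]) auto
  qed
qed

text \<open>Two coefficient vectors in the subbox of side \<open>M\<close> differ by at most
  \<open>M\<close> in each entry, so dissociativity makes their sums distinct. This will bound the
  size of dissociated sets of directions.\<close>

lemma card_dissociated_power_le:
  fixes X D :: "nat set"
  assumes D: "finite D" "dissociated M D" and X: "finite X" and M: "M \<le> l"
    and box: "\<And>c. (\<forall>d\<in>D. c d \<le> l) \<Longrightarrow> x + (\<Sum>d\<in>D. c d * d) \<in> X"
  shows "(M + 1) ^ card D \<le> card X"
proof -
  define P where "P = PiE D (\<lambda>_. {0..M})"
  have "card P \<le> card X"
  proof (rule card_inj_on_le)
    show "inj_on (\<lambda>c. x + (\<Sum>d\<in>D. c d * d)) P"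
    proof (rule inj_onI)
      fix b c assume bc: "b \<in> P" "c \<in> P" "x + (\<Sum>d\<in>D. b d * d) = x + (\<Sum>d\<in>D. c d * d)"
      have "int (\<Sum>d\<in>D. b d * d) = int (\<Sum>d\<in>D. c d * d)"
        using bc(3) by simp
      then have "(\<Sum>d\<in>D. (int (b d) - int (c d)) * int d) = 0"
        by (simp add: algebra_simps sum_subtractf)
      moreover have "\<bar>int (b d) - int (c d)\<bar> \<le> int M" if "d \<in> D" for d
      proof -
        have "b d \<le> M" "c d \<le> M"
          using bc(1,2) that by (auto simp: P_def)
        then show ?thesis by linarith
      qed
      ultimately have "\<forall>d\<in>D. int (b d) - int (c d) = 0"
        by (intro D(2)[unfolded dissociated_def, THEN spec, THEN mp]) (intro conjI ballI)
      then have "b d = c d" if "d \<in> D" for d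
        using that by simp
      then show "b = c"
        using bc(1,2) unfolding P_def by (metis PiE_ext)
    qed
    show "(\<lambda>c. x + (\<Sum>d\<in>D. c d * d)) ` P \<subseteq> X"
    proof (intro image_subsetI box ballI)
      fix c d assume "c \<in> P" "d \<in> D"
      then have "c d \<le> M"
        by (auto simp: P_def)
      then show "c d \<le> l"
        using M by simp
    qed
    show "finite X" by fact
  qed
  then show ?thesis
    using D(1) by (simp add: P_def card_PiE)
qed

section \<open>Progressions from polynomially many subset sums\<close>

text \<open>Adding an element \<open>a\<close> outside \<open>E\<close> turns possibly empty sums
  into nonempty ones. The \<open>s\<close> steps give \<open>s + 1\<close> terms.\<close>

lemma contains_AP_subset_sums:
  assumes "E \<subseteq># A" "a \<in># A - E" "0 < d" "\<forall>i\<le>s. y + i * d \<in> msums E"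
  shows "contains_AP (subset_sums A) (s + 1)"
proof -
  have "(a + y) + i * d \<in> subset_sums A" if "i < s + 1" for i
    using add_msums_in_subset_sums[OF assms(1,2), of "y + i * d"] assms(4) that by (simp add: add.assoc)
  then show ?thesis
    unfolding contains_AP_def using assms(3) by (intro exI[of _ "a + y"] exI[of _ d]) auto
qed

text \<open>This fixes the parameters of \<open>extract_GAP\<close> for a multiset with at most
  \<open>size A ^ C\<close> sums: boxes of side linear in \<open>size A\<close>, built from at most
  half of the elements.\<close>

lemma GAP_in_subset_sums:
  fixes C G :: nat
  defines "W \<equiv> 16 * C * G"
  assumes CG: "1 \<le> C" "1 \<le> G" and A: "16 * W ^ 2 \<le> size A" "card (msums A) \<le> size A ^ C"
  shows "\<exists>E. E \<subseteq># A \<and> 2 * size E \<le> size A \<and>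
    (\<forall>T. T \<subseteq> set_mset (A - E) \<and> card T \<le> G \<longrightarrow> contains_box (msums E) T (size A div W))"
proof -
  define m where "m = size A"
  define q where "q = m div W"
  \<comment> \<open>With \<open>t = 2 * K * q\<close> the blocks cost \<open>4 * K * G * q\<close>,
    at most half of \<open>m\<close>. The binomial coefficient is at least
    \<open>(2 * q + 1) ^ K\<close>, the \<open>C\<close>-th power of a square that exceeds
    \<open>16 * m\<close> because \<open>q\<close> is at least \<open>16 * W\<close>; and
    \<open>4 ^ K * m ^ C\<close> is the \<open>C\<close>-th power of \<open>16 * m\<close>.\<close>
  define K where "K = 2 * C"
  define t where "t = 2 * K * q"
  have W: "1 \<le> W" "W = 8 * K * G"
    using CG by (auto simp: W_def K_def)
  have qW: "q * W \<le> m" "m < W * (q + 1)"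
    using W(1) by (simp_all add: q_def dividend_less_times_div)
  have q: "16 * W \<le> q"
  proof -
    have "(16 * W * W) div W \<le> m div W"
      using A(1) by (intro div_le_mono) (simp add: m_def power2_eq_square)
    then show ?thesis
      using W(1) by (simp add: q_def)
  qed
  have K: "1 \<le> K" "K \<le> t"
    using CG q W(1) by (auto simp: K_def t_def)
  have sz: "2 * (G * (2 * K * q + t)) \<le> size A"
    using qW(1) by (simp add: t_def W(2) m_def algebra_simps)
  have small: "4 ^ K * card (msums A) < (t + K) choose K"
  proof -
    have "16 * m < 16 * (W * (q + 1))"
      using qW(2) by simp
    also have "\<dots> = (16 * W) * (q + 1)"
      by simp
    also have "\<dots> \<le> q * (q + 1)"
      using q by (rule mult_right_mono) simp
    also have "\<dots> \<le> (2 * q + 1) ^ 2"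
      by (simp add: power2_eq_square algebra_simps)
    finally have 1: "16 * m < (2 * q + 1) ^ 2" .
    have "4 ^ K * card (msums A) \<le> 4 ^ K * m ^ C"
      using A(2) by (simp add: m_def)
    also have "\<dots> = (16 * m) ^ C"
      by (simp add: K_def power_mult power_mult_distrib)
    also have "\<dots> < ((2 * q + 1) ^ 2) ^ C"
      using 1 CG(1) by (intro power_strict_mono) auto
    also have "\<dots> = (2 * q + 1) ^ K"
      by (simp add: K_def power_mult)
    finally have 2: "4 ^ K * card (msums A) < (2 * q + 1) ^ K" .
    have "real (t + K) / real K = real (2 * q + 1)"
      using K by (simp add: t_def field_simps)
    then have "real ((2 * q + 1) ^ K) \<le> real ((t + K) choose K)"
      using binomial_ge_n_over_k_pow_k[of K "t + K", where 'a = real] by simp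
    then show ?thesis
      using 2 by linarith
  qed
  obtain E where E: "E \<subseteq># A" "size E \<le> G * (2 * K * q + t)"
    "\<And>T. T \<subseteq> set_mset (A - E) \<Longrightarrow> card T \<le> G \<Longrightarrow> contains_box (msums E) T q"
    using extract_GAP[OF K _ small, of G q] sz by auto
  have "2 * size E \<le> size A"
    using E(2) sz by linarith
  then show ?thesis
    using E(1,3) unfolding q_def m_def by blast
qed

text \<open>A box in the single direction of one remaining element is a progression of linear
  length; excluding \<open>0\<close> makes its difference positive.\<close>

lemma AP_length_linear:
  fixes C :: nat
  assumes C: "1 \<le> C"
  shows "\<exists>c>0. \<exists>m0. \<forall>A. m0 \<le> size A \<and> 0 \<notin># A \<and> card (msums A) \<le> size A ^ C \<longrightarrow>
    (\<exists>L. contains_AP (subset_sums A) L \<and> c * real (size A) \<le> real L)"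
proof -
  define W where "W = 16 * C * 1"
  have "\<exists>L. contains_AP (subset_sums A) L \<and> (1 / real W) * real (size A) \<le> real L"
    if A: "16 * W ^ 2 \<le> size A" "0 \<notin># A" "card (msums A) \<le> size A ^ C" for A
  proof -
    obtain E where E: "E \<subseteq># A" "2 * size E \<le> size A"
      and box: "\<And>T. T \<subseteq> set_mset (A - E) \<Longrightarrow> card T \<le> 1 \<Longrightarrow> contains_box (msums E) T (size A div W)"
      using GAP_in_subset_sums[OF C le_refl, folded W_def, OF A(1,3)] by blast
    have "0 < W"
      using C by (simp add: W_def)
    then have "0 < 16 * W ^ 2"
      by simp
    then have "0 < size A"
      using A(1) by linarith
    then have "size (A - E) \<noteq> 0"
      using E by (simp add: size_Diff_submset)
    then obtain a where a: "a \<in># A - E"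
      by (metis multiset_nonemptyE size_empty)
    have "contains_box (msums E) {a} (size A div W)"
      using a by (intro box) auto
    then obtain x where x: "\<forall>c. c a \<le> size A div W \<longrightarrow> x + c a * a \<in> msums E"
      unfolding contains_box_def by auto
    have "a \<noteq> 0"
      using a A(2) by (metis in_diffD)
    moreover have "x + i * a \<in> msums E" if "i \<le> size A div W" for i
      using x[THEN spec, of "\<lambda>_. i"] that by simp
    ultimately have "contains_AP (subset_sums A) (size A div W + 1)"
      by (intro contains_AP_subset_sums[OF E(1) a]) auto
    moreover have "(1 / real W) * real (size A) \<le> real (size A div W + 1)"
    proof -
      have "size A < W * (size A div W + 1)"
        using C by (simp add: W_def dividend_less_times_div)
      then have "real (size A) \<le> real W * real (size A div W + 1)"
        by (metis less_imp_le of_nat_le_iff of_nat_mult)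
      then show ?thesis
        using C by (simp add: W_def field_simps)
    qed
    ultimately show ?thesis by blast
  qed
  moreover have "0 < 1 / real W"
    using C by (simp add: W_def)
  ultimately show ?thesis by blast
qed

lemma size_eq_card_set_mset:
  assumes "\<And>a. count A a \<le> 1"
  shows "size A = card (set_mset A)"
proof -
  have "count A a = 1" if "a \<in># A" for a
    using that assms[of a] by (metis count_greater_eq_one_iff le_antisym)
  then show ?thesis
    by (simp add: size_multiset_overloaded_eq)
qed

text \<open>Few subset sums bound the size of dissociated sets among the remaining elements by
  \<open>2 * C\<close>. As these elements are distinct and numerous, they have a short direction,
  along which the box contains a progression longer by a factor of order \<open>s\<close>.\<close>

lemma AP_from_dimension:
  fixes C s :: nat
  defines "G \<equiv> 2 * C + 1"
  defines "W \<equiv> 16 * C * G"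
  assumes C: "1 \<le> C" and A: "32 * W ^ 2 \<le> size A" "card (msums A) \<le> size A ^ C"
    and dist: "\<And>a. count A a \<le> 1" and s: "2 \<le> s"
    and many: "2 * (2 * C + (2 * s ^ (2 * C) + 1) ^ G) < size A"
  shows "contains_AP (subset_sums A) (s * (size A div W div 8) + 1)"
proof -
  define m where "m = size A"
  define q where "q = m div W"
  have W: "1 \<le> W"
    using C by (auto simp: W_def G_def)
  have qW: "q * W \<le> m" "m < W * (q + 1)"
    using W by (simp_all add: q_def dividend_less_times_div)
  have q: "32 * W \<le> q"
  proof -
    have "(32 * W * W) div W \<le> m div W"
      using A(1) by (intro div_le_mono) (simp add: m_def power2_eq_square)
    then show ?thesis
      using W(1) by (simp add: q_def)
  qed
  obtain E where E: "E \<subseteq># A" "2 * size E \<le> m"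
    and box: "\<And>T. T \<subseteq> set_mset (A - E) \<Longrightarrow> card T \<le> G \<Longrightarrow> contains_box (msums E) T q"
  proof -
    have "1 \<le> G" "16 * W ^ 2 \<le> size A"
      using A(1) by (simp_all add: G_def)
    from GAP_in_subset_sums[OF C this(1), folded W_def, OF this(2) A(2)] show ?thesis
      using that unfolding m_def q_def by blast
  qed
  define R where "R = set_mset (A - E)"
  have "count (A - E) a \<le> 1" for a
    using dist[of a] by simp
  then have cardR: "m \<le> 2 * card R"
    using size_eq_card_set_mset[of "A - E"] E by (simp add: R_def size_Diff_submset m_def)
  \<comment> \<open>The square root is large enough that \<open>(M + 1) ^ (2 * C + 1)\<close>
    exceeds \<open>m ^ C\<close>, which bounds the dimension, and small enough that
    \<open>4 * M\<close> is at most the side \<open>q\<close>.\<close>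
  define M where "M = nat \<lfloor>sqrt (real m)\<rfloor>"
  have M: "M ^ 2 \<le> m" "m \<le> (M + 1) ^ 2" "1 \<le> M"
  proof -
    have s0: "real M \<le> sqrt (real m)" "sqrt (real m) \<le> real (M + 1)"
      by (simp_all add: M_def) linarith
    have "real (M ^ 2) \<le> real m"
      using power_mono[OF s0(1), of 2] by simp
    then show "M ^ 2 \<le> m" by linarith
    have "real m \<le> real ((M + 1) ^ 2)"
      using power_mono[OF s0(2), of 2] by simp
    then show "m \<le> (M + 1) ^ 2" by linarith
    have "m \<ge> 1"
      using W qW(1) q by (metis One_nat_def Suc_le_eq less_le_trans mult_pos_pos less_numeral_extra(1) zero_less_numeral)
    then show "1 \<le> M"
      by (simp add: M_def le_nat_iff le_floor_iff)
  qed
  have Mq: "4 * M \<le> q"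
  proof -
    have "(4 * M) ^ 2 = 16 * M ^ 2"
      by (simp add: power_mult_distrib)
    also have "\<dots> \<le> 16 * (W * (q + 1))"
      using M(1) qW(2) by linarith
    also have "\<dots> \<le> (32 * W) * q"
      using q W by (simp add: algebra_simps)
    also have "\<dots> \<le> q ^ 2"
      using q by (simp add: power2_eq_square)
    finally show ?thesis
      by (rule power2_le_imp_le) simp
  qed
  have dim: "card D \<le> 2 * C" if D: "D \<subseteq> R" "dissociated M D" for D
  proof (rule ccontr)
    assume "\<not> ?thesis"
    then have "G \<le> card D"
      by (simp add: G_def)
    then obtain D' where D': "D' \<subseteq> D" "card D' = G" "finite D'"
      by (rule obtain_subset_with_card_n)
    \<comment> \<open>Boxes are available only for at most \<open>G\<close> directions, so
      \<open>D\<close> is cut down to \<open>G\<close> elements; relations on the subset extend by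
      zero.\<close>
    have "dissociated M D'"
      unfolding dissociated_def
    proof (intro allI impI)
      fix c :: "nat \<Rightarrow> int"
      assume c: "(\<forall>d\<in>D'. \<bar>c d\<bar> \<le> int M) \<and> (\<Sum>d\<in>D'. c d * int d) = 0"
      have finD: "finite D"
        using D(1) finite_subset by (auto simp: R_def)
      define b where "b d = (if d \<in> D' then c d else 0)" for d
      have "(\<Sum>d\<in>D. b d * int d) = (\<Sum>d\<in>D'. c d * int d)"
        using finD D'(1) by (intro sum.mono_neutral_cong_right) (auto simp: b_def)
      then have "\<forall>d\<in>D. b d = 0"
        using c by (intro D(2)[unfolded dissociated_def, THEN spec, THEN mp]) (auto simp: b_def)
      then show "\<forall>d\<in>D'. c d = 0"
        using D'(1) by (metis b_def subsetD)
    qed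
    then have dis: "dissociated M D'" .
    have "D' \<subseteq> set_mset (A - E)" "card D' \<le> G"
      using D' D(1) by (auto simp: R_def)
    from box[OF this] obtain x where
      x: "\<forall>c. (\<forall>d\<in>D'. c d \<le> q) \<longrightarrow> x + (\<Sum>d\<in>D'. c d * d) \<in> msums E"
      unfolding contains_box_def ..
    have "(M + 1) ^ card D' \<le> card (msums E)"
    proof (rule card_dissociated_power_le[where l = q and x = x, OF D'(3) dis finite_msums])
      show "x + (\<Sum>d\<in>D'. c d * d) \<in> msums E" if "\<forall>d\<in>D'. c d \<le> q" for c
        by (rule x[THEN spec, THEN mp, OF that])
    qed (use Mq in simp)
    also have "\<dots> \<le> m ^ C"
      using card_msums_mono[OF E(1)] A(2) by (simp add: m_def)
    also have "\<dots> \<le> ((M + 1) ^ 2) ^ C"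
      by (rule power_mono[OF M(2)]) simp
    also have "\<dots> = (M + 1) ^ (2 * C)"
      by (simp only: power_mult)
    also have "\<dots> < (M + 1) ^ card D'"
      using M(3) by (intro power_strict_increasing) (auto simp: D'(2) G_def)
    finally show False by simp
  qed
  have "2 * C + (2 * s ^ (2 * C) + 1) ^ (2 * C + 1) < card R"
    using many cardR by (simp add: G_def m_def)
  then obtain T w where T: "T \<subseteq> R" "card T \<le> G" and w: "w \<noteq> 0" "short_dir s M T w"
    using ex_short_direction[of R M "2 * C" s] dim s by (auto simp: G_def R_def)
  from box[OF T[unfolded R_def]] obtain x where
    x: "\<forall>c. (\<forall>d\<in>T. c d \<le> q) \<longrightarrow> x + (\<Sum>d\<in>T. c d * d) \<in> msums E"
    unfolding contains_box_def ..
  \<comment> \<open>Then \<open>2 * l\<close> takes at most a quarter of the side, and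
    \<open>2 * M\<close> at most half.\<close>
  define l where "l = q div 8"
  have "8 * l \<le> q"
    unfolding l_def by (rule times_div_less_eq_dividend)
  then have l: "2 * (l + M) \<le> q"
    using Mq by presburger
  have "\<exists>y d. d > 0 \<and> (\<forall>i\<le>s * l. y + i * d \<in> msums E)"
  proof (rule AP_in_GAP[where T = T and l = q and x = x and w = w and M = M])
    show "finite T"
      using T(1) finite_subset by (auto simp: R_def)
    show "2 * (l + M) \<le> q"
      by (rule l)
    show "x + (\<Sum>d\<in>T. c d * d) \<in> msums E" if "\<forall>d\<in>T. c d \<le> q" for c
      by (rule x[THEN spec, THEN mp, OF that])
  qed (use s w in simp_all)
  then obtain y d where "0 < d" "\<forall>i\<le>s * l. y + i * d \<in> msums E"
    by blast
  moreover have "card R \<noteq> 0"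
    using cardR many by (intro notI) (simp add: m_def)
  then obtain a where "a \<in># A - E"
    unfolding R_def by fastforce
  ultimately show ?thesis
    using contains_AP_subset_sums[OF E(1)] unfolding l_def q_def m_def by blast
qed

text \<open>Here \<open>s\<close> is taken as large as the counting condition of
  \<open>AP_from_dimension\<close> permits. That condition is of order \<open>s ^ Q\<close> against
  \<open>size A\<close>, so \<open>s\<close> is of order \<open>size A\<close> to the power
  \<open>1 / Q\<close>, the gain over linear length.\<close>

lemma AP_length_superlinear:
  fixes C :: nat
  assumes C: "1 \<le> C"
  shows "\<exists>c>0. \<exists>m0. \<forall>A. m0 \<le> size A \<and> (\<forall>a. count A a \<le> 1) \<and> card (msums A) \<le> size A ^ C \<longrightarrow>
    (\<exists>L. contains_AP (subset_sums A) L \<and> c * real (size A) powr (1 + 1 / real (2 * C * (2 * C + 1))) \<le> real L)"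
proof -
  define Q where "Q = 2 * C * (2 * C + 1)"
  define W where "W = 16 * C * (2 * C + 1)"
  \<comment> \<open>The base \<open>3\<close> comes from bounding \<open>2 * s ^ (2 * C) + 1\<close>
    by \<open>3 * s ^ (2 * C)\<close>. The factor \<open>4\<close> keeps this term within half of
    \<open>m\<close>, and \<open>8 * C < m\<close> handles the other half.\<close>
  define Z :: nat where "Z = 4 * 3 ^ (2 * C + 1)"
  \<comment> \<open>The divisor \<open>64 * W\<close> consists of \<open>32 * W\<close> for the two
    integer divisions giving \<open>q div 8\<close>, and \<open>2\<close> for rounding
    \<open>z\<close> down to \<open>s\<close>.\<close>
  define c where "c = (1 / real Z) powr (1 / real Q) / (64 * real W)"
  \<comment> \<open>The term \<open>Z * 2 ^ Q\<close> ensures that \<open>s\<close> is at least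
    \<open>2\<close>.\<close>
  define m0 where "m0 = 32 * W ^ 2 + Z * 2 ^ Q + 8 * C + 1"
  have QW: "1 \<le> Q" "1 \<le> W" "1 \<le> Z"
    using C by (auto simp: Q_def W_def Z_def)
  have "\<exists>L. contains_AP (subset_sums A) L \<and> c * real (size A) powr (1 + 1 / real Q) \<le> real L"
    if A: "m0 \<le> size A" "\<And>a. count A a \<le> 1" "card (msums A) \<le> size A ^ C" for A
  proof -
    define m where "m = size A"
    define q where "q = m div W"
    define z where "z = (real m / real Z) powr (1 / real Q)"
    define s where "s = nat \<lfloor>z\<rfloor>"
    have m: "32 * W ^ 2 \<le> m" "Z * 2 ^ Q \<le> m" "8 * C < m"
      using A(1) by (simp_all add: m0_def m_def)
    have "real (Z * 2 ^ Q) \<le> real m"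
      using m(2) by (rule of_nat_mono)
    then have "2 ^ Q \<le> real m / real Z"
      using QW by (simp add: field_simps)
    then have "(2 ^ Q) powr (1 / real Q) \<le> z"
      unfolding z_def by (intro powr_mono2) auto
    moreover have "(2 ^ Q) powr (1 / real Q) = (2::real)"
      using QW by (simp add: powr_powr flip: powr_realpow)
    ultimately have z: "2 \<le> z"
      by simp
    then have s: "2 \<le> s" "real s \<le> z" "z \<le> 2 * real s"
      by (simp_all add: s_def le_nat_iff le_floor_iff) linarith
    have "z ^ Q = real m / real Z"
      using m(3) QW by (simp add: z_def powr_powr flip: powr_realpow)
    then have "real (s ^ Q) \<le> real m / real Z"
      using power_mono[OF s(2), of Q] by simp
    then have "real (Z * s ^ Q) \<le> real m"
      using QW by (simp add: field_simps)
    then have sQ: "Z * s ^ Q \<le> m"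
      by linarith
    have "(2 * s ^ (2 * C) + 1) ^ (2 * C + 1) \<le> (3 * s ^ (2 * C)) ^ (2 * C + 1)"
      using s(1) by (intro power_mono) auto
    also have "\<dots> = 3 ^ (2 * C + 1) * s ^ Q"
      by (simp only: power_mult_distrib Q_def power_mult)
    finally have "4 * (2 * s ^ (2 * C) + 1) ^ (2 * C + 1) \<le> m"
      using sQ by (simp add: Z_def)
    then have many: "2 * (2 * C + (2 * s ^ (2 * C) + 1) ^ (2 * C + 1)) < size A"
      using m(3) by (simp add: m_def)
    have "contains_AP (subset_sums A) (s * (q div 8) + 1)"
      using AP_from_dimension[OF C _ A(3,2) s(1) many] m(1) unfolding W_def q_def m_def by blast
    moreover have "c * real m powr (1 + 1 / real Q) \<le> real (s * (q div 8) + 1)"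
    proof -
      have q: "32 * W \<le> q"
      proof -
        have "(32 * W * W) div W \<le> m div W"
          using m(1) by (intro div_le_mono) (simp add: power2_eq_square)
        then show ?thesis
          using QW by (simp add: q_def)
      qed
      have "m < W * (q + 1)"
        using QW by (simp add: q_def dividend_less_times_div)
      also have "\<dots> \<le> W * (32 * (q div 8))"
        using q QW by (intro mult_left_mono) auto
      finally have "m \<le> 32 * W * (q div 8)"
        by simp
      then have "real m \<le> real (32 * W * (q div 8))"
        by (rule of_nat_mono)
      then have 1: "real m / (32 * real W) \<le> real (q div 8)"
        using QW by (simp add: field_simps)
      have "c * real m powr (1 + 1 / real Q) =
          (real m / (32 * real W)) * (((1 / real Z) powr (1 / real Q) * real m powr (1 / real Q)) / 2)"
        using m(3) by (simp add: c_def powr_add)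
      also have "(1 / real Z) powr (1 / real Q) * real m powr (1 / real Q) = z"
        by (simp add: z_def flip: powr_mult)
      also have "(real m / (32 * real W)) * (z / 2) \<le> real (q div 8) * real s"
        using 1 s z by (intro mult_mono) auto
      also have "\<dots> \<le> real (s * (q div 8) + 1)"
        by simp
      finally show ?thesis .
    qed
    ultimately show ?thesis
      unfolding m_def by blast
  qed
  moreover have "0 < c"
    using QW by (simp add: c_def)
  ultimately show ?thesis
    unfolding Q_def by blast
qed

section \<open>Sets satisfying the cube and progression conditions\<close>

lemma ex_disjoint_submultisets:
  assumes "k * n \<le> size A"
  shows "\<exists>P. (\<Sum>i\<in>{1..k}. P i) \<subseteq># A \<and> (\<forall>i\<in>{1..k}. size (P i) = n)"
  using assms
proof (induction k)
  case 0
  then show ?case by simp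
next
  case (Suc k)
  then obtain P where P: "(\<Sum>i\<in>{1..k}. P i) \<subseteq># A" "\<forall>i\<in>{1..k}. size (P i) = n"
    by auto
  have "size (\<Sum>i\<in>{1..k}. P i) = k * n"
    using P(2) by (simp add: size_multiset_sum)
  then have "n \<le> size (A - (\<Sum>i\<in>{1..k}. P i))"
    using P(1) Suc.prems by (simp add: size_Diff_submset)
  then obtain B where B: "B \<subseteq># A - (\<Sum>i\<in>{1..k}. P i)" "size B = n"
    using ex_submultiset_size by blast
  define P' where "P' = P(Suc k := B)"
  have "(\<Sum>i\<in>{1..Suc k}. P' i) = (\<Sum>i\<in>{1..k}. P i) + B"
    by (simp add: P'_def)
  also have "\<dots> \<subseteq># A"
    using B(1) P(1) by (simp add: subset_mset.le_diff_conv2 add.commute)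
  finally show ?case
    using P(2) B(2) by (intro exI[of _ P']) (auto simp: P'_def)
qed

lemma subset_sums_union:
  assumes "x \<in> subset_sums A" "y \<in> subset_sums B"
  shows "x + y \<in> subset_sums (A + B)"
proof -
  obtain X Y where "X \<subseteq># A" "X \<noteq> {#}" "x = sum_mset X" "Y \<subseteq># B" "y = sum_mset Y"
    using assms by (auto simp: subset_sums_def)
  then show ?thesis
    using subset_sumsI[of "X + Y" "A + B"] by (simp add: subset_mset.add_mono)
qed

lemma sum_subset_sums:
  assumes "finite I" "I \<noteq> {}" "\<And>i. i \<in> I \<Longrightarrow> x i \<in> subset_sums (P i)"
  shows "(\<Sum>i\<in>I. x i) \<in> subset_sums (\<Sum>i\<in>I. P i)"
  using assms
proof (induction I rule: finite_ne_induct)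
  case (insert i I)
  then show ?case
    by (auto intro!: subset_sums_union)
qed simp

lemma cube_AP_freeD:
  assumes "cube_AP_free S k a f g" "1 \<le> N"
  shows "2 \<le> f N"
    and "\<lbrakk>\<And>i. i \<in> {1..k} \<Longrightarrow> B i \<subseteq> {1..N};
      \<And>I. I \<subseteq> {1..k} \<Longrightarrow> I \<noteq> {} \<Longrightarrow> a +o (\<Sum>i\<in>I. B i) \<subseteq> S\<rbrakk>
      \<Longrightarrow> real (MIN i\<in>{1..k}. card (B i)) \<le> f N"
    and "g N \<le> real L \<Longrightarrow> \<not> contains_AP (S \<inter> {a..a + N}) L"
proof -
  note * = assms(1)[unfolded cube_AP_free_def, THEN spec, THEN mp, OF assms(2)]
  show "2 \<le> f N"
    using * by (rule conjunct1)
  show "\<lbrakk>\<And>i. i \<in> {1..k} \<Longrightarrow> B i \<subseteq> {1..N};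
      \<And>I. I \<subseteq> {1..k} \<Longrightarrow> I \<noteq> {} \<Longrightarrow> a +o (\<Sum>i\<in>I. B i) \<subseteq> S\<rbrakk>
      \<Longrightarrow> real (MIN i\<in>{1..k}. card (B i)) \<le> f N"
    by (rule *[THEN conjunct2, THEN conjunct1, THEN spec, THEN mp, THEN mp]) simp_all
  show "g N \<le> real L \<Longrightarrow> \<not> contains_AP (S \<inter> {a..a + N}) L"
    by (rule *[THEN conjunct2, THEN conjunct2, THEN spec, THEN mp])
qed

text \<open>Minkowski sums of the subset sums of disjoint parts consist of subset sums of
  \<open>A\<close>, so the cube condition applies to the \<open>k\<close> parts and the one with
  fewest sums is taken. Excluding \<open>0\<close> from \<open>A\<close> puts the sums into
  \<open>{1..N}\<close>.\<close>

lemma cube_AP_free_part: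
  assumes S: "cube_AP_free S k a f g" and k: "1 \<le> k" and N: "1 \<le> N" and A0: "0 \<notin># A"
    and A: "a +o subset_sums A \<subseteq> S \<inter> {a..a + N}"
  shows "\<exists>P. P \<subseteq># A \<and> size P = size A div k \<and> real (card (subset_sums P)) \<le> f N"
proof -
  obtain P where P: "(\<Sum>i\<in>{1..k}. P i) \<subseteq># A" and sz: "\<And>i. i \<in> {1..k} \<Longrightarrow> size (P i) = size A div k"
    using ex_disjoint_submultisets[of k "size A div k" A] by auto
  define B where "B i = subset_sums (P i)" for i
  have PI: "(\<Sum>i\<in>I. P i) \<subseteq># A" if "I \<subseteq> {1..k}" for I
  proof -
    have "(\<Sum>i\<in>I. P i) \<subseteq># (\<Sum>i\<in>{1..k}. P i)"
      using sum.subset_diff[OF that, of P] by simp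
    then show ?thesis
      using P by (rule subset_mset.order_trans)
  qed
  have 1: "B i \<subseteq> {1..N}" if "i \<in> {1..k}" for i
  proof
    fix x assume "x \<in> B i"
    then have x: "x \<in> subset_sums A"
      using PI[of "{i}"] that subset_sums_mono[of "P i" A] by (auto simp: B_def)
    then have "a + x \<in> {a..a + N}"
      using A by (auto simp: elt_set_plus_def)
    then show "x \<in> {1..N}"
      using subset_sums_pos[OF A0 x] by simp
  qed
  have 2: "a +o (\<Sum>i\<in>I. B i) \<subseteq> S" if "I \<subseteq> {1..k}" "I \<noteq> {}" for I
  proof -
    have fin: "finite I"
      using that(1) finite_subset by blast
    have "(\<Sum>i\<in>I. B i) \<subseteq> subset_sums A"
    proof
      fix y assume "y \<in> (\<Sum>i\<in>I. B i)"
      then obtain x where x: "y = (\<Sum>i\<in>I. x i)" "\<forall>i\<in>I. x i \<in> B i"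
        unfolding set_sum_alt[OF fin] by blast
      then have "y \<in> subset_sums (\<Sum>i\<in>I. P i)"
        using fin that(2) by (auto simp: B_def intro!: sum_subset_sums)
      then show "y \<in> subset_sums A"
        using subset_sums_mono[OF PI[OF that(1)]] by blast
    qed
    then have "a +o (\<Sum>i\<in>I. B i) \<subseteq> a +o subset_sums A"
      by (rule set_plus_mono)
    then show ?thesis
      using A by blast
  qed
  have "real (MIN i\<in>{1..k}. card (B i)) \<le> f N"
    using 1 2 by (rule cube_AP_freeD(2)[OF S N])
  moreover have "(MIN i\<in>{1..k}. card (B i)) \<in> (\<lambda>i. card (B i)) ` {1..k}"
    using k by (intro Min_in) auto
  then obtain i where "i \<in> {1..k}" "(MIN i\<in>{1..k}. card (B i)) = card (B i)"
    by blast
  ultimately show ?thesis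
    using PI[of "{i}"] sz[of i] by (intro exI[of _ "P i"]) (auto simp: B_def)
qed

lemma cube_AP_free_AP_length_less:
  assumes S: "cube_AP_free S k a f g" and N: "1 \<le> N"
    and A: "a +o subset_sums A \<subseteq> S \<inter> {a..a + N}" and AP: "contains_AP (subset_sums A) L"
  shows "real L < g N"
proof (rule ccontr)
  assume "\<not> ?thesis"
  then have "\<not> contains_AP (S \<inter> {a..a + N}) L"
    using cube_AP_freeD(3)[OF S N] by simp
  moreover obtain b d where bd: "d > 0" "(\<lambda>i. b + i * d) ` {..<L} \<subseteq> subset_sums A"
    using AP by (auto simp: contains_AP_def)
  have "a + b + i * d \<in> S \<inter> {a..a + N}" if "i < L" for i
  proof -
    have "b + i * d \<in> subset_sums A"
      using bd(2) that by blast
    then have "a + (b + i * d) \<in> a +o subset_sums A"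
      by (rule set_plus_intro2)
    then show ?thesis
      using A by (metis add.assoc subsetD)
  qed
  then have "contains_AP (S \<inter> {a..a + N}) L"
    unfolding contains_AP_def using bd(1) by (intro exI[of _ "a + b"] exI[of _ d]) auto
  ultimately show False by simp
qed

lemma contains_AP_subset: "contains_AP T L \<Longrightarrow> T \<subseteq> U \<Longrightarrow> contains_AP U L"
  unfolding contains_AP_def by blast

text \<open>The empty progression, of length \<open>0\<close>, is contained in every set.\<close>

lemma cube_AP_free_g_pos: "cube_AP_free S k a f g \<Longrightarrow> 1 \<le> N \<Longrightarrow> 0 < g N"
  using cube_AP_freeD(3)[of S k a f g N 0] by (force simp: contains_AP_def)

lemma card_msums_le_double:
  fixes F :: real
  assumes "card (subset_sums P) \<le> F" "2 \<le> F"
  shows "real (card (msums P)) \<le> 2 * F"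
proof -
  have "card (msums P) \<le> card (subset_sums P) + 1"
    unfolding msums_eq_subset_sums by (metis Suc_eq_plus1 card_insert_le_m1 card_insert_if finite_subset_sums le_refl le_SucI)
  then show ?thesis
    using assms by linarith
qed

section \<open>The three bounds\<close>

text \<open>A part with at most \<open>f N\<close> sums has no progression of \<open>s\<close> steps
  for \<open>s\<close> about \<open>g N\<close>, so exponential growth bounds its size by a multiple
  of \<open>s * ln (f N)\<close>.\<close>

lemma size_le_log:
  assumes S: "cube_AP_free S k a f g" and k: "1 \<le> k" and N: "1 \<le> N" and A0: "0 \<notin># A"
    and A: "a +o subset_sums A \<subseteq> S \<inter> {a..a + N}"
  shows "real (size A) \<le> 10 * (real k * g N * ln (f N))"
proof (cases "A = {#}")
  case True
  have "0 < g N" "2 \<le> f N"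
    using cube_AP_free_g_pos[OF S N] cube_AP_freeD(1)[OF S N] .
  then show ?thesis
    using True by simp
next
  case False
  define F where "F = f N"
  define r where "r = g N"
  have F: "2 \<le> F"
    using cube_AP_freeD(1)[OF S N] by (simp add: F_def)
  have lnF: "1 / 2 \<le> ln F"
  proof -
    have "- ln F \<le> 1 / F - 1"
      using ln_le_minus_one[of "1 / F"] F by (simp add: ln_div)
    moreover have "1 / F \<le> 1 / 2"
      using F by simp
    ultimately show ?thesis by linarith
  qed
  obtain P where P: "P \<subseteq># A" "size P = size A div k" "real (card (subset_sums P)) \<le> F"
    using cube_AP_free_part[OF S k N A0 A] unfolding F_def by blast
  have less: "real L < r" if "contains_AP (subset_sums A) L" for L
    using cube_AP_free_AP_length_less[OF S N A that] by (simp add: r_def)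
  \<comment> \<open>A single element of \<open>A\<close> is a progression of length
    \<open>1\<close>. This makes the rounded value \<open>s\<close> at most
    \<open>2 * r\<close>.\<close>
  have r1: "1 < r"
  proof -
    obtain b where "b \<in> subset_sums A"
      using False set_mset_subset_sums by (metis multiset_nonemptyE subsetD)
    then have "contains_AP (subset_sums A) 1"
      unfolding contains_AP_def by (intro exI[of _ b] exI[of _ 1]) auto
    then show ?thesis
      using less by fastforce
  qed
  define s where "s = nat \<lceil>r\<rceil>"
  have s: "r \<le> real s" "real s \<le> r + 1" "0 < s"
    using r1 by (auto simp: s_def)
  have noAP: "\<not> (\<exists>x. \<forall>i\<le>s. x + i * b \<in> msums P)" if "b \<in># P" for b
  proof
    assume "\<exists>x. \<forall>i\<le>s. x + i * b \<in> msums P"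
    then obtain x where x: "\<And>i. i \<le> s \<Longrightarrow> x + i * b \<in> msums P"
      by blast
    have b: "b > 0"
      using that A0 P(1) by (metis gr0I mset_subset_eqD)
    \<comment> \<open>Dropping the first of the \<open>s + 1\<close> terms makes all others
      positive, hence nonempty sums; the remaining length \<open>s\<close> is still at least
      \<open>g N\<close>.\<close>
    have "x + b + i * b \<in> subset_sums P" if "i < s" for i
      using x[of "Suc i"] that b by (auto simp: msums_eq_subset_sums add.assoc)
    then have "contains_AP (subset_sums P) s"
      unfolding contains_AP_def using b by (intro exI[of _ "x + b"] exI[of _ b]) auto
    then have "real s < r"
      by (intro less contains_AP_subset[OF _ subset_sums_mono[OF P(1)]])
    then show False
      using s(1) by simp
  qed
  define m where "m = size P"
  have "(s + 1) ^ m \<le> card (msums P) * s ^ m"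
    unfolding m_def by (rule msums_exponential_growth[OF s(3) noAP])
  then have "real ((s + 1) ^ m) \<le> real (card (msums P) * s ^ m)"
    by (rule of_nat_mono)
  then have "(real s + 1) ^ m / real s ^ m \<le> real (card (msums P))"
    using s(3) by (simp add: pos_divide_le_eq add.commute)
  moreover have "1 + 1 / real s = (real s + 1) / real s"
    using s(3) by (simp add: field_simps)
  ultimately have "(1 + 1 / real s) ^ m \<le> real (card (msums P))"
    by (simp add: power_divide)
  also have "\<dots> \<le> 2 * F"
    using card_msums_le_double[OF P(3) F] .
  also have "\<dots> \<le> F ^ 2"
    using F by (simp add: power2_eq_square)
  finally have le: "(1 + 1 / real s) ^ m \<le> F ^ 2" .
  have "ln ((1 + 1 / real s) ^ m) \<le> ln (F ^ 2)"
    using s(3) F by (intro ln_mono le zero_less_power add_pos_nonneg) auto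
  then have 1: "real m * ln (1 + 1 / real s) \<le> 2 * ln F"
    using s(3) F by (simp add: ln_realpow add_pos_nonneg)
  have "ln (1 + 1 / real s) \<ge> (1 / real s) / 2"
  proof -
    have "- ln (1 - 1 / (real s + 1)) \<ge> 1 / (real s + 1)"
      using ln_le_minus_one[of "1 - 1 / (real s + 1)"] s(3) by (simp add: field_simps)
    moreover have "1 + 1 / real s = inverse (1 - 1 / (real s + 1))"
      using s(3) by (simp add: field_simps)
    then have "ln (1 + 1 / real s) = - ln (1 - 1 / (real s + 1))"
      using s(3) by (simp add: ln_inverse)
    moreover have "1 / (real s + 1) \<ge> (1 / real s) / 2"
      using s(3) by (simp add: field_simps)
    ultimately show ?thesis by linarith
  qed
  then have "real m * ((1 / real s) / 2) \<le> 2 * ln F"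
    using 1 by (meson mult_left_mono of_nat_0_le_iff order_trans)
  then have "real m \<le> 4 * real s * ln F"
    using s(3) by (simp add: field_simps)
  also have "\<dots> \<le> 4 * (2 * r) * ln F"
    using s(2) r1 lnF by (intro mult_right_mono) auto
  finally have m: "real m \<le> 8 * r * ln F"
    by simp
  \<comment> \<open>This absorbs the \<open>1\<close> lost in the division by \<open>k\<close>: it
    is at most \<open>2 * r * ln F\<close>, which turns the constant \<open>8\<close> into
    \<open>10\<close>.\<close>
  have "1 * (1 / 2) \<le> r * ln F"
    using r1 lnF by (intro mult_mono) auto
  then have "real m + 1 \<le> 10 * (r * ln F)"
    using m by linarith
  moreover have "size A < k * (m + 1)"
    using k P(2) by (simp add: m_def dividend_less_times_div)
  then have "real (size A) \<le> real k * (real m + 1)"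
    by (metis less_imp_le of_nat_le_iff of_nat_mult of_nat_add of_nat_1)
  ultimately have "real (size A) \<le> real k * (10 * (r * ln F))"
    by (meson mult_left_mono of_nat_0_le_iff order_trans)
  then show ?thesis
    by (simp add: F_def r_def mult_ac)
qed

text \<open>As \<open>C\<close> is at least \<open>1 / \<epsilon>\<close>, the bound
  \<open>2 * F\<close> is at most the \<open>C\<close>-th power of
  \<open>2 * F powr \<epsilon>\<close>, and so of \<open>size P\<close>.\<close>

lemma polynomial_card_msums:
  assumes F: "2 \<le> F" "real (card (subset_sums P)) \<le> F" and \<epsilon>: "0 < \<epsilon>" "1 / \<epsilon> \<le> real C"
    and big: "2 * F powr \<epsilon> < real (size P)"
  shows "card (msums P) \<le> size P ^ C"
proof -
  have C: "0 < real C"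
    using \<epsilon> by (meson divide_pos_pos less_le_trans zero_less_one)
  have "real (card (msums P)) \<le> 2 * F"
    using card_msums_le_double[OF F(2,1)] .
  also have "\<dots> = 2 * (F powr \<epsilon>) powr (1 / \<epsilon>)"
    using F(1) \<epsilon> by (simp add: powr_powr)
  also have "\<dots> \<le> 2 ^ C * (F powr \<epsilon>) powr real C"
  proof (intro mult_mono powr_mono)
    show "2 \<le> (2::real) ^ C"
      using C by (metis of_nat_0_less_iff self_le_power one_le_numeral)
    show "1 \<le> F powr \<epsilon>"
      using F(1) \<epsilon>(1) by (simp add: ge_one_powr_ge_zero)
  qed (use \<epsilon> in auto)
  also have "\<dots> = (2 * F powr \<epsilon>) ^ C"
    using F(1) by (simp add: power_mult_distrib powr_realpow)
  also have "\<dots> \<le> real (size P) ^ C"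
    using big by (intro power_mono) auto
  finally show ?thesis
    by (metis of_nat_le_iff of_nat_power)
qed

lemma size_bound_from_part:
  assumes k: "1 \<le> (k::nat)" and y: "1 \<le> (y::real)" and "real (n div k) \<le> D * y" "0 \<le> D"
  shows "real n \<le> real k * (D + 1) * y"
proof -
  have "n < k * (n div k + 1)"
    using k by (simp add: dividend_less_times_div)
  then have "real n \<le> real k * (real (n div k) + 1)"
    by (metis less_imp_le of_nat_le_iff of_nat_mult of_nat_add of_nat_1)
  also have "\<dots> \<le> real k * (D * y + y)"
    using assms by (intro mult_left_mono) auto
  finally show ?thesis
    by (simp add: algebra_simps)
qed

text \<open>A part \<open>P\<close> with at most \<open>f N\<close> sums is of bounded size, or at
  most \<open>2 * f N powr \<epsilon>\<close>, or has only polynomially many sums in terms of its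
  size. In the last case \<open>AP_length_linear\<close> gives a progression whose length is below
  \<open>g N\<close>.\<close>

lemma size_le_max_powr:
  fixes k :: nat and \<epsilon> :: real
  assumes k: "1 \<le> k" and \<epsilon>: "0 < \<epsilon>"
  shows "\<exists>C>0. \<forall>S a f g. cube_AP_free S k a f g \<longrightarrow> (\<forall>N\<ge>1. \<forall>A.
    0 \<notin># A \<and> a +o subset_sums A \<subseteq> S \<inter> {a..a + N} \<longrightarrow>
    real (size A) \<le> C * max (f N powr \<epsilon>) (g N))"
proof -
  define C where "C = nat \<lceil>1 / \<epsilon>\<rceil>"
  have C: "1 \<le> C" "1 / \<epsilon> \<le> real C"
  proof -
    show "1 / \<epsilon> \<le> real C"
      by (simp add: C_def real_nat_ceiling_ge)
    then show "1 \<le> C"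
      using \<epsilon> by (metis One_nat_def Suc_leI divide_pos_pos less_le_trans of_nat_0_less_iff zero_less_one)
  qed
  obtain c m0 where c: "0 < c" and AP: "\<And>A. m0 \<le> size A \<Longrightarrow> 0 \<notin># A \<Longrightarrow> card (msums A) \<le> size A ^ C \<Longrightarrow>
      \<exists>L. contains_AP (subset_sums A) L \<and> c * real (size A) \<le> real L"
    using AP_length_linear[OF C(1)] by blast
  define D where "D = real m0 + 2 + 1 / c"
  have D: "real m0 \<le> D" "2 \<le> D" "1 / c \<le> D" "0 \<le> D"
    using c by (simp_all add: D_def)
  have "real (size A) \<le> real k * (D + 1) * max (f N powr \<epsilon>) (g N)"
    if S: "cube_AP_free S k a f g" and N: "1 \<le> N" and A0: "0 \<notin># A"
      and A: "a +o subset_sums A \<subseteq> S \<inter> {a..a + N}" for S a f g N A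
  proof -
    define y where "y = max (f N powr \<epsilon>) (g N)"
    have F: "2 \<le> f N"
      using cube_AP_freeD(1)[OF S N] .
    have y: "1 \<le> f N powr \<epsilon>" "f N powr \<epsilon> \<le> y" "g N \<le> y"
      using F \<epsilon> by (auto simp: ge_one_powr_ge_zero y_def)
    obtain P where P: "P \<subseteq># A" "size P = size A div k" "real (card (subset_sums P)) \<le> f N"
      using cube_AP_free_part[OF S k N A0 A] by blast
    consider "size P < m0" | "real (size P) \<le> 2 * f N powr \<epsilon>" |
      "m0 \<le> size P" "2 * f N powr \<epsilon> < real (size P)"
      by linarith
    then have "real (size P) \<le> D * y"
    proof cases
      case 1
      then have "real (size P) \<le> D * 1"
        using D(1) by simp
      also have "\<dots> \<le> D * y"
        using D(4) y by (intro mult_left_mono) auto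
      finally show ?thesis .
    next
      case 2
      also have "2 * f N powr \<epsilon> \<le> D * y"
        using D y by (intro mult_mono) auto
      finally show ?thesis .
    next
      case 3
      have "0 \<notin># P"
        using A0 P(1) by (metis mset_subset_eqD)
      then obtain L where L: "contains_AP (subset_sums P) L" "c * real (size P) \<le> real L"
        using AP[OF 3(1)] polynomial_card_msums[OF F P(3) \<epsilon> C(2) 3(2)] by blast
      have "real L < g N"
        using cube_AP_free_AP_length_less[OF S N A] contains_AP_subset[OF L(1) subset_sums_mono[OF P(1)]]
        by blast
      then have "c * real (size P) \<le> y"
        using L(2) y(3) by linarith
      then have "real (size P) \<le> 1 / c * y"
        using c by (simp add: field_simps)
      also have "\<dots> \<le> D * y"
        using D(3) y by (intro mult_right_mono) auto
      finally show ?thesis .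
    qed
    then show ?thesis
      unfolding y_def[symmetric] using size_bound_from_part[OF k _ _ D(4), of y "size A"] y P(2) by simp
  qed
  moreover have "0 < real k * (D + 1)"
    using k D by simp
  ultimately show ?thesis by blast
qed

text \<open>The exponent gain \<open>1 / (Q + 1)\<close> of the argument, with
  \<open>Q = 2 * C * (2 * C + 1)\<close>, is at least the stated one: the number under the factorial
  is at least \<open>2 * C + 2\<close>, and already \<open>(2 * C + 2) * (2 * C + 1)\<close> exceeds
  \<open>Q + 1\<close>.\<close>

lemma delta_le:
  fixes k C :: nat
  assumes k: "2 \<le> k" and \<epsilon>: "0 < \<epsilon>" "\<epsilon> < 1" and C: "real C < 1 / \<epsilon> + 1" "2 \<le> C"
  shows "delta k \<epsilon> \<le> 1 / real (2 * C * (2 * C + 1) + 1)" "0 \<le> delta k \<epsilon>"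
proof -
  define x where "x = 2 * (3 * real k / \<epsilon> - 1)"
  define D where "D = nat (\<lfloor>x\<rfloor> + 1)"
  have "2 * 3 * 2 * (1 / \<epsilon>) \<le> 2 * 3 * real k * (1 / \<epsilon>)"
    using k \<epsilon> by (intro mult_right_mono) auto
  then have "12 * (1 / \<epsilon>) - 2 \<le> x"
    by (simp add: x_def)
  then have "12 * real C - 14 < x"
    using C(1) by linarith
  then have "12 * real C - 14 < real_of_int (\<lfloor>x\<rfloor> + 1)"
    by linarith
  then have "12 * int C - 14 < \<lfloor>x\<rfloor> + 1"
    by linarith
  then have D: "2 * C + 2 \<le> D"
    using C(2) by (simp add: D_def)
  have "(2 * C + 2) * ((2 * C + 1) * 1) \<le> (2 * C + 2) * ((2 * C + 1) * fact (2 * C))"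
    by (intro mult_left_mono) (auto simp: fact_ge_1)
  also have "\<dots> = fact (2 * C + 2)"
    by (simp add: numeral_2_eq_2)
  also have "\<dots> \<le> fact D"
    by (rule fact_mono_nat[OF D])
  finally have "2 * C * (2 * C + 1) + 1 \<le> (fact D :: nat)"
    by (simp add: algebra_simps)
  then have "real (2 * C * (2 * C + 1) + 1) \<le> fact D"
    by (metis of_nat_fact of_nat_le_iff)
  then show "delta k \<epsilon> \<le> 1 / real (2 * C * (2 * C + 1) + 1)"
    unfolding delta_def x_def[symmetric] D_def[symmetric]
    by (intro divide_left_mono mult_pos_pos) (simp_all del: of_nat_add of_nat_mult)
  show "0 \<le> delta k \<epsilon>"
    by (simp add: delta_def)
qed

text \<open>The same case distinction with superlinear progressions:
  \<open>size P powr (1 + 1 / Q)\<close> is bounded by a multiple of \<open>g N\<close>, and the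
  inverse exponent \<open>Q / (Q + 1)\<close> is at most
  \<open>1 - delta k \<epsilon>\<close>.\<close>

lemma card_le_max_powr:
  fixes k :: nat and \<epsilon> :: real
  assumes k: "2 \<le> k" and \<epsilon>: "0 < \<epsilon>"
  shows "\<exists>C>0. \<forall>S a f g. cube_AP_free S k a f g \<longrightarrow> (\<forall>N\<ge>1. \<forall>A.
    finite A \<and> 0 \<notin> A \<and> a +o subset_sums (mset_set A) \<subseteq> S \<inter> {a..a + N} \<longrightarrow>
    real (card A) \<le> C * max (f N powr \<epsilon>) (g N powr (1 - delta k \<epsilon>)))"
proof -
  define C where "C = max 2 (nat \<lceil>1 / \<epsilon>\<rceil>)"
  have C: "1 \<le> C" "2 \<le> C" "1 / \<epsilon> \<le> real C"
    using real_nat_ceiling_ge[of "1 / \<epsilon>"] by (auto simp: C_def)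
  define Q where "Q = 2 * C * (2 * C + 1)"
  define \<eta> where "\<eta> = 1 - delta k \<epsilon>"
  obtain c m0 where c: "0 < c" and AP: "\<And>A. m0 \<le> size A \<Longrightarrow> \<forall>a. count A a \<le> 1 \<Longrightarrow>
      card (msums A) \<le> size A ^ C \<Longrightarrow>
      \<exists>L. contains_AP (subset_sums A) L \<and> c * real (size A) powr (1 + 1 / real Q) \<le> real L"
    using AP_length_superlinear[OF C(1)] unfolding Q_def by blast
  define c' where "c' = c powr \<eta>"
  have c': "0 < c'"
    using c by (simp add: c'_def)
  define D where "D = real m0 + 2 + 1 / c'"
  have D: "real m0 \<le> D" "2 \<le> D" "1 / c' \<le> D" "0 \<le> D"
    using c' by (simp_all add: D_def)
  have "real (card A) \<le> real k * (D + 1) * max (f N powr \<epsilon>) (g N powr \<eta>)"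
    if S: "cube_AP_free S k a f g" and N: "1 \<le> N" and A0: "finite A" "0 \<notin> A"
      and A: "a +o subset_sums (mset_set A) \<subseteq> S \<inter> {a..a + N}" for S a f g N A
  proof -
    define y where "y = max (f N powr \<epsilon>) (g N powr \<eta>)"
    have F: "2 \<le> f N"
      using cube_AP_freeD(1)[OF S N] .
    have y: "1 \<le> f N powr \<epsilon>" "f N powr \<epsilon> \<le> y" "g N powr \<eta> \<le> y"
      using F \<epsilon> by (auto simp: ge_one_powr_ge_zero y_def)
    have k1: "1 \<le> k"
      using k by simp
    obtain P where P: "P \<subseteq># mset_set A" "size P = card A div k" "real (card (subset_sums P)) \<le> f N"
      using cube_AP_free_part[OF S k1 N _ A] A0 by auto
    have P1: "count P b \<le> 1" for b
      using P(1) A0(1) by (metis count_mset_set(1,3) le_trans le_refl mset_subset_eq_count zero_le)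
    consider "size P < m0" | "real (size P) \<le> 2 * f N powr \<epsilon>" |
      "m0 \<le> size P" "2 * f N powr \<epsilon> < real (size P)"
      by linarith
    then have "real (size P) \<le> D * y"
    proof cases
      case 1
      then have "real (size P) \<le> D * 1"
        using D(1) by simp
      also have "\<dots> \<le> D * y"
        using D(4) y by (intro mult_left_mono) auto
      finally show ?thesis .
    next
      case 2
      also have "2 * f N powr \<epsilon> \<le> D * y"
        using D y by (intro mult_mono) auto
      finally show ?thesis .
    next
      case 3
      \<comment> \<open>The elements of \<open>P\<close> are distinct and are themselves subset
        sums, so \<open>size P\<close> is at most \<open>f N\<close>; for larger
        \<open>\<epsilon>\<close> this case cannot occur.\<close>
      have "\<epsilon> < 1"
      proof (rule ccontr)
        assume "\<not> \<epsilon> < 1"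
        then have "f N powr 1 \<le> f N powr \<epsilon>"
          using F by (intro powr_mono) auto
        moreover have "card (set_mset P) \<le> card (subset_sums P)"
          by (intro card_mono set_mset_subset_sums) simp
        then have "real (size P) \<le> f N"
          using P(3) size_eq_card_set_mset[OF P1] by linarith
        ultimately show False
          using 3(2) F by simp
      qed
      then have "1 < 1 / \<epsilon>"
        using \<epsilon> by simp
      then have "real C < 1 / \<epsilon> + 1"
        unfolding C_def by (auto simp: max_def) linarith+
      from delta_le[OF k \<epsilon> \<open>\<epsilon> < 1\<close> this C(2), folded Q_def]
      have \<delta>: "delta k \<epsilon> \<le> 1 / (real Q + 1)" "0 \<le> delta k \<epsilon>"
        by (simp_all add: add.commute)
      have "1 \<le> Q"
        using C(1) by (simp add: Q_def)
      then have Q: "1 \<le> real Q"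
        by simp
      have "1 / (real Q + 1) \<le> 1"
        using Q by simp
      then have \<eta>0: "0 \<le> \<eta>"
        using \<delta>(1) unfolding \<eta>_def by linarith
      have "real Q / (real Q + 1) \<le> \<eta>"
        using \<delta>(1) Q by (simp add: \<eta>_def field_simps)
      then have "(1 + 1 / real Q) * (real Q / (real Q + 1)) \<le> (1 + 1 / real Q) * \<eta>"
        using Q by (intro mult_left_mono) auto
      moreover have "1 + 1 / real Q = (real Q + 1) / real Q"
        using Q by (simp add: field_simps)
      then have "(1 + 1 / real Q) * (real Q / (real Q + 1)) = 1"
        using Q by simp
      ultimately have e: "1 \<le> (1 + 1 / real Q) * \<eta>"
        by (simp only:)
      obtain L where L: "contains_AP (subset_sums P) L"
        "c * real (size P) powr (1 + 1 / real Q) \<le> real L"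
        using AP[OF 3(1)] P1 polynomial_card_msums[OF F P(3) \<epsilon> C(3) 3(2)] by blast
      have "real L < g N"
        using cube_AP_free_AP_length_less[OF S N A] contains_AP_subset[OF L(1) subset_sums_mono[OF P(1)]]
        by blast
      then have le: "c * real (size P) powr (1 + 1 / real Q) \<le> g N"
        using L(2) by linarith
      have sz: "1 \<le> real (size P)"
        using 3(2) y(1) by linarith
      have "c' * real (size P) powr 1 \<le> c' * real (size P) powr ((1 + 1 / real Q) * \<eta>)"
        using c' sz e by (intro mult_left_mono powr_mono) auto
      also have "\<dots> = (c * real (size P) powr (1 + 1 / real Q)) powr \<eta>"
        using c by (simp add: c'_def powr_mult powr_powr)
      also have "\<dots> \<le> g N powr \<eta>"
        using c \<eta>0 by (intro powr_mono2 le) auto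
      finally have "c' * real (size P) \<le> y"
        using y(3) sz by simp
      then have "real (size P) \<le> 1 / c' * y"
        using c' by (simp add: field_simps)
      also have "\<dots> \<le> D * y"
        using D(3) y by (intro mult_right_mono) auto
      finally show ?thesis .
    qed
    then show ?thesis
      unfolding y_def[symmetric] using size_bound_from_part[OF k1 _ _ D(4), of y "card A"] y P(2) by simp
  qed
  moreover have "0 < real k * (D + 1)"
    using k D by simp
  ultimately show ?thesis
    unfolding \<eta>_def by blast
qed

theorem theorem3p1:
  shows "(\<exists>C>0. \<forall>(S :: nat set) (k :: nat) (a\<^sub>0 :: nat) (f :: nat \<Rightarrow> real) (g :: nat \<Rightarrow> real).
            0 \<notin> S \<and> k \<ge> 2 \<and> cube_AP_free S k a\<^sub>0 f g \<longrightarrow>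
            (\<forall>N\<ge>1. \<forall>A :: nat multiset.
               0 \<notin># A \<and> a\<^sub>0 +o subset_sums A \<subseteq> S \<inter> {a\<^sub>0..a\<^sub>0 + N} \<longrightarrow>
               real (size A) \<le> C * (real k * g N * ln (f N))))
       \<and> (\<forall>(k :: nat) (\<epsilon> :: real). k \<ge> 2 \<and> \<epsilon> > 0 \<longrightarrow>
          (\<exists>C>0. \<forall>(S :: nat set) (a\<^sub>0 :: nat) (f :: nat \<Rightarrow> real) (g :: nat \<Rightarrow> real).
            0 \<notin> S \<and> cube_AP_free S k a\<^sub>0 f g \<and> filterlim f at_top sequentially \<longrightarrow>
            (\<forall>N\<ge>1. \<forall>A :: nat multiset.
               0 \<notin># A \<and> a\<^sub>0 +o subset_sums A \<subseteq> S \<inter> {a\<^sub>0..a\<^sub>0 + N} \<longrightarrow>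
               real (size A) \<le> C * max (f N powr \<epsilon>) (g N))))
       \<and> (\<forall>(k :: nat) (\<epsilon> :: real). k \<ge> 2 \<and> \<epsilon> > 0 \<longrightarrow>
          (\<exists>C>0. \<forall>(S :: nat set) (a\<^sub>0 :: nat) (f :: nat \<Rightarrow> real) (g :: nat \<Rightarrow> real).
            0 \<notin> S \<and> cube_AP_free S k a\<^sub>0 f g \<and> filterlim f at_top sequentially \<longrightarrow>
            (\<forall>N\<ge>1. \<forall>A :: nat set.
               finite A \<and> 0 \<notin> A \<and>
               a\<^sub>0 +o subset_sums (mset_set A) \<subseteq> S \<inter> {a\<^sub>0..a\<^sub>0 + N} \<longrightarrow>
               real (card A) \<le> C * max (f N powr \<epsilon>) (g N powr (1 - delta k \<epsilon>)))))"
proof (intro conjI allI impI)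
  show "\<exists>C>0. \<forall>(S :: nat set) (k :: nat) (a\<^sub>0 :: nat) (f :: nat \<Rightarrow> real) (g :: nat \<Rightarrow> real).
      0 \<notin> S \<and> k \<ge> 2 \<and> cube_AP_free S k a\<^sub>0 f g \<longrightarrow>
      (\<forall>N\<ge>1. \<forall>A :: nat multiset.
         0 \<notin># A \<and> a\<^sub>0 +o subset_sums A \<subseteq> S \<inter> {a\<^sub>0..a\<^sub>0 + N} \<longrightarrow>
         real (size A) \<le> C * (real k * g N * ln (f N)))"
    using size_le_log by (intro exI[of _ 10]) auto
next
  fix k :: nat and \<epsilon> :: real
  assume k: "k \<ge> 2 \<and> \<epsilon> > 0"
  then have k1: "1 \<le> k"
    by simp
  show "\<exists>C>0. \<forall>(S :: nat set) (a\<^sub>0 :: nat) (f :: nat \<Rightarrow> real) (g :: nat \<Rightarrow> real).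
      0 \<notin> S \<and> cube_AP_free S k a\<^sub>0 f g \<and> filterlim f at_top sequentially \<longrightarrow>
      (\<forall>N\<ge>1. \<forall>A :: nat multiset.
         0 \<notin># A \<and> a\<^sub>0 +o subset_sums A \<subseteq> S \<inter> {a\<^sub>0..a\<^sub>0 + N} \<longrightarrow>
         real (size A) \<le> C * max (f N powr \<epsilon>) (g N))"
    using size_le_max_powr[OF k1 conjunct2[OF k]] by blast
  show "\<exists>C>0. \<forall>(S :: nat set) (a\<^sub>0 :: nat) (f :: nat \<Rightarrow> real) (g :: nat \<Rightarrow> real).
      0 \<notin> S \<and> cube_AP_free S k a\<^sub>0 f g \<and> filterlim f at_top sequentially \<longrightarrow>
      (\<forall>N\<ge>1. \<forall>A :: nat set.
         finite A \<and> 0 \<notin> A \<and> a\<^sub>0 +o subset_sums (mset_set A) \<subseteq> S \<inter> {a\<^sub>0..a\<^sub>0 + N} \<longrightarrow>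
         real (card A) \<le> C * max (f N powr \<epsilon>) (g N powr (1 - delta k \<epsilon>)))"
  proof -
    obtain C where C: "C > 0 \<and> (\<forall>S a f g. cube_AP_free S k a f g \<longrightarrow> (\<forall>N\<ge>1. \<forall>A.
        finite A \<and> 0 \<notin> A \<and> a +o subset_sums (mset_set A) \<subseteq> S \<inter> {a..a + N} \<longrightarrow>
        real (card A) \<le> C * max (f N powr \<epsilon>) (g N powr (1 - delta k \<epsilon>))))"
      using card_le_max_powr[OF conjunct1[OF k] conjunct2[OF k]] ..
    show ?thesis
    proof (rule exI[of _ C], intro conjI allI impI)
      fix S a f g N A
      assume "0 \<notin> S \<and> cube_AP_free S k a f g \<and> filterlim f at_top sequentially" "1 \<le> N"
        and A: "finite A \<and> 0 \<notin> A \<and> a +o subset_sums (mset_set A) \<subseteq> S \<inter> {a..a + N}"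
      then show "real (card A) \<le> C * max (f N powr \<epsilon>) (g N powr (1 - delta k \<epsilon>))"
        by (intro C[THEN conjunct2, rule_format, OF _ _ A]) simp_all
    qed (rule conjunct1[OF C])
  qed
qed

end
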